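(* Let $G=(V,E)$ be a finite quiver without self-loops, with $V=\{1,\dots,p\}$, let $n_v\ge1$ be integers for $v\in V$, let $x_e\ge0$ be real numbers for $e\in E$ such that $z_{s(e)}\ne0$ for every $e\in E$, and let $(U_e)_{e\in E}$ be complex matrices, $U_e$ of size $n_{s(e)}\times n_{t(e)}$. Let $\Delta$ be the associated twisted Laplacian, and set $p_e=x_e/z_{s(e)}$ for all $e\in E$. If $G$ has only a finite number of prime cycles, then $$\det\Delta=\underline{z}^{\underline{n}}\prod_{\mathsf{c}\in\mathcal{P}(G)}\det\big(I-\underline{p}^{\underline{e}(\mathsf{c})}\operatorname{hol}(\mathsf{c})\big).$$
   Context: A finite quiver is a finite directed graph (multiple edges allowed); each edge $e$ goes from $s(e)$ to $t(e)$, and no self-loops means $s(e)\ne t(e)$ for all $e$. The twisted Laplacian is the endomorphism of $\bigoplus_{v\in V}\mathbb{C}^{n_v}$ given by $\Delta f(v)=\sum_{e\in E:\,s(e)=v}x_e\,[f(s(e))-U_ef(t(e))]$. For $a\in V$, $z_a=\sum_{e\in E:\,s(e)=a}x_e$, and $\underline{z}^{\underline{n}}=\prod_{a\in V}z_a^{n_a}$. A cycle $\mathsf{c}$ on $G$ is a sequence of edges $(e_1,\dots,e_k)$, $k\ge 1$, with $t(e_i)=s(e_{i+1})$ for $1\le i<k$ and $t(e_k)=s(e_1)$, considered up to cyclic permutation (vertices and edges may be repeated). Its valuation is the order of the stabiliser of $(e_1,\dots,e_k)$ under the cyclic shift action of $\mathbb{Z}/k\mathbb{Z}$; $\mathcal{P}(G)$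 is the set of prime cycles, i.e. cycles on $G$ of valuation $1$. $\underline{p}^{\underline{e}(\mathsf{c})}=p_{e_1}\cdots p_{e_k}$, and $\operatorname{hol}(\mathsf{c})=U_{e_1}\cdots U_{e_k}\in M_{n_{s(e_1)}}(\mathbb{C})$; this matrix depends on the starting point but $\det(I-\underline{p}^{\underline{e}(\mathsf{c})}\operatorname{hol}(\mathsf{c}))$ (with $I=I_{n_{s(e_1)}}$) does not. *)

theory Defs
  imports
    Complex_Main
    "Graph_Theory.Arc_Walk"
    "Jordan_Normal_Form.Determinant"
begin

text \<open>
  A quiver is a \<^const>\<open>fin_digraph\<close> (parallel arcs allowed) with an arc \<open>e\<close> going from \<open>tail G e\<close>
  to \<open>head G e\<close>.  So the \<open>tail\<close> is the source \<open>s(e)\<close> and the \<open>head\<close> is the target \<open>t(e)\<close>.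
\<close>

definition out_weight :: "(nat, 'e) pre_digraph \<Rightarrow> ('e \<Rightarrow> real) \<Rightarrow> nat \<Rightarrow> real" where
  "out_weight G x a = (\<Sum>e\<in>out_arcs G a. x e)"

definition arc_prob :: "(nat, 'e) pre_digraph \<Rightarrow> ('e \<Rightarrow> real) \<Rightarrow> 'e \<Rightarrow> real" where
  "arc_prob G x e = x e / out_weight G x (tail G e)"

section \<open>The twisted Laplacian and its determinant\<close>

text \<open>
  Elements of the direct sum of the spaces of dimension \<open>n v\<close>, for \<open>v \<in> V\<close>, are families \<open>f\<close> with
  \<open>f v \<in> carrier_vec (n v)\<close> for \<open>v \<in> V\<close>; the values of \<open>f\<close> outside \<open>V\<close> are irrelevant.
\<close>

definition twisted_laplacian ::
  "(nat, 'e) pre_digraph \<Rightarrow> (nat \<Rightarrow> nat) \<Rightarrow> ('e \<Rightarrow> real) \<Rightarrow> ('e \<Rightarrow> complex mat)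
    \<Rightarrow> (nat \<Rightarrow> complex vec) \<Rightarrow> (nat \<Rightarrow> complex vec)" where
  "twisted_laplacian G n x U f v =
    finsum_vec TYPE(complex) (n v)
      (\<lambda>e. complex_of_real (x e) \<cdot>\<^sub>v (f (tail G e) - U e *\<^sub>v f (head G e))) (out_arcs G v)"

definition dsum_index :: "nat set \<Rightarrow> (nat \<Rightarrow> nat) \<Rightarrow> (nat \<times> nat) list" where
  "dsum_index V n = concat (map (\<lambda>v. map (Pair v) [0..<n v]) (sorted_list_of_set V))"

definition dsum_unit :: "(nat \<Rightarrow> nat) \<Rightarrow> nat \<times> nat \<Rightarrow> (nat \<Rightarrow> complex vec)" where
  "dsum_unit n = (\<lambda>(v, i) w. if w = v then unit_vec (n v) i else 0\<^sub>v (n w))"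

text \<open>The matrix and the determinant of an endomorphism \<open>T\<close> of the direct sum, computed in its
  standard basis, listed in the order of \<^const>\<open>dsum_index\<close>.\<close>

definition dsum_mat ::
  "nat set \<Rightarrow> (nat \<Rightarrow> nat) \<Rightarrow> ((nat \<Rightarrow> complex vec) \<Rightarrow> (nat \<Rightarrow> complex vec)) \<Rightarrow> complex mat" where
  "dsum_mat V n T =
    (let b = dsum_index V n in
      mat (length b) (length b) (\<lambda>(k, l). T (dsum_unit n (b ! l)) (fst (b ! k)) $ snd (b ! k)))"

definition dsum_det ::
  "nat set \<Rightarrow> (nat \<Rightarrow> nat) \<Rightarrow> ((nat \<Rightarrow> complex vec) \<Rightarrow> (nat \<Rightarrow> complex vec)) \<Rightarrow> complex" where
  "dsum_det V n T = det (dsum_mat V n T)"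

section \<open>Prime cycles\<close>

text \<open>
  A cycle is a nonempty closed sequence of arcs up to cyclic permutation, with repetitions allowed.
  The library's \<^const>\<open>pre_digraph.cycle\<close> means a simple cycle and is a different notion.
\<close>

definition cycle_rel :: "('v, 'e) pre_digraph \<Rightarrow> 'e list rel" where
  "cycle_rel G = {(es, fs). wf_digraph.closed_w G es \<and> wf_digraph.closed_w G fs
                            \<and> (\<exists>k. fs = rotate k es)}"

definition cycles :: "('v, 'e) pre_digraph \<Rightarrow> 'e list set set" where
  "cycles G = {es. wf_digraph.closed_w G es} // cycle_rel G"

definition cycle_rep :: "'e list set \<Rightarrow> 'e list" where
  "cycle_rep c = (SOME es. es \<in> c)"

definition valuation :: "'e list \<Rightarrow> nat" where
  "valuation es = card {k \<in> {0..<length es}. rotate k es = es}"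

text \<open>Neither the valuation nor the determinants below depend on the chosen representative, see
  \<open>valuation_cycle_rep\<close> and \<open>cycle_det_cycle_rep\<close>.\<close>

definition prime_cycles :: "('v, 'e) pre_digraph \<Rightarrow> 'e list set set" where
  "prime_cycles G = {c \<in> cycles G. valuation (cycle_rep c) = 1}"

definition holonomy ::
  "(nat, 'e) pre_digraph \<Rightarrow> (nat \<Rightarrow> nat) \<Rightarrow> ('e \<Rightarrow> complex mat) \<Rightarrow> 'e list \<Rightarrow> complex mat" where
  "holonomy G n U es = foldr (\<lambda>e M. U e * M) es (1\<^sub>m (n (tail G (hd es))))"

definition cycle_det ::
  "(nat, 'e) pre_digraph \<Rightarrow> (nat \<Rightarrow> nat) \<Rightarrow> ('e \<Rightarrow> real) \<Rightarrow> ('e \<Rightarrow> complex mat) \<Rightarrow> 'e list \<Rightarrow> complex" where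
  "cycle_det G n q U es =
    det (1\<^sub>m (n (tail G (hd es)))
         - complex_of_real (\<Prod>e\<leftarrow>es. q e) \<cdot>\<^sub>m holonomy G n U es)"

section \<open>Well-definedness\<close>

lemma valuation_rotate: "valuation (rotate m es) = valuation es"
proof -
  have "rotate k (rotate m es) = rotate m es \<longleftrightarrow> rotate k es = es" for k
  proof -
    have "inj (rotate m :: 'a list \<Rightarrow> 'a list)"
      by (induction m) (auto simp: inj_def rotate_def rotate1_rotate_swap
          intro: injD[OF inj_rotate1])
    moreover have "rotate k (rotate m es) = rotate m (rotate k es)"
      by (simp add: rotate_rotate add.commute)
    ultimately show ?thesis by (simp only: inj_eq)
  qed
  then show ?thesis by (simp add: valuation_def)
qed

lemma equiv_cycle_rel: "equiv {es. wf_digraph.closed_w G es} (cycle_rel G)"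
proof (rule equivI)
  show "refl_on {es. wf_digraph.closed_w G es} (cycle_rel G)"
    unfolding refl_on_def cycle_rel_def by (auto intro: exI[of _ 0])
  show "cycle_rel G \<subseteq> {es. wf_digraph.closed_w G es} \<times> {es. wf_digraph.closed_w G es}"
    by (auto simp: cycle_rel_def)
  show "sym (cycle_rel G)"
  proof (rule symI, clarsimp simp: cycle_rel_def)
    fix es k
    assume "wf_digraph.closed_w G (rotate k es)"
    have "rotate (length es - k mod length es) (rotate k es) = es"
    proof (cases "es = []")
      case False
      have "rotate k es = rotate (k mod length es) es" by (rule rotate_conv_mod)
      with False show ?thesis by (simp add: rotate_rotate less_imp_le)
    qed simp
    then show "\<exists>l. es = rotate l (rotate k es)" by (intro exI) (rule sym)
  qed
  show "trans (cycle_rel G)"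
    by (rule transI) (auto simp: cycle_rel_def rotate_rotate)
qed

lemma cycle_rep_in: "c \<in> cycles G \<Longrightarrow> cycle_rep c \<in> c"
  unfolding cycles_def cycle_rep_def
  using in_quotient_imp_non_empty[OF equiv_cycle_rel] by (metis someI_ex ex_in_conv)

lemma cycle_rep_rotate:
  assumes "c \<in> cycles G" "es \<in> c"
  obtains k where "cycle_rep c = rotate k es"
  using quotient_eqI[OF equiv_cycle_rel] in_quotient_imp_in_rel[OF equiv_cycle_rel, of c G es "cycle_rep c"]
    cycle_rep_in[OF assms(1)] assms that
  by (auto simp: cycles_def cycle_rel_def)

lemma valuation_cycle_rep:
  assumes "c \<in> cycles G" "es \<in> c"
  shows "valuation (cycle_rep c) = valuation es"
  using cycle_rep_rotate[OF assms] valuation_rotate by metis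

lemma det_one_minus_mult_commute:
  fixes A B :: "complex mat"
  assumes A: "A \<in> carrier_mat n m" and B: "B \<in> carrier_mat m n"
  shows "det (1\<^sub>m n - A * B) = det (1\<^sub>m m - B * A)"
proof -
  let ?P = "four_block_mat (1\<^sub>m n) A B (1\<^sub>m m)"
  let ?Q = "four_block_mat (1\<^sub>m n) (0\<^sub>m n m) (- B) (1\<^sub>m m)"
  have P: "?P \<in> carrier_mat (n + m) (n + m)" and Q: "?Q \<in> carrier_mat (n + m) (n + m)"
    by auto
  have cA: "A * (- B) = - (A * B)" and cB: "(- B) * A = - (B * A)"
    using A B by auto
  have "?P * ?Q = four_block_mat (1\<^sub>m n - A * B) A (0\<^sub>m m n) (1\<^sub>m m)"
    using A B by (subst mult_four_block_mat[OF one_carrier_mat A B one_carrier_mat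
          one_carrier_mat zero_carrier_mat _ one_carrier_mat])
      (auto simp: cA intro!: cong_four_block_mat eq_matI)
  then have "det (?P * ?Q) = det (1\<^sub>m n - A * B)"
    using A B by (simp, subst det_four_block_mat_lower_left_zero[of _ n _ m]) (auto intro: minus_carrier_mat)
  moreover have "?Q * ?P = four_block_mat (1\<^sub>m n) A (0\<^sub>m m n) (1\<^sub>m m - B * A)"
    using A B by (subst mult_four_block_mat[OF one_carrier_mat zero_carrier_mat _ one_carrier_mat
          one_carrier_mat A B one_carrier_mat])
      (auto simp: cB intro!: cong_four_block_mat eq_matI)
  then have "det (?Q * ?P) = det (1\<^sub>m m - B * A)"
    using A B by (simp, subst det_four_block_mat_lower_left_zero[of _ n _ m]) (auto intro: minus_carrier_mat)
  ultimately show ?thesis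
    using det_mult[OF P Q] det_mult[OF Q P] by (simp add: mult.commute)
qed

lemma foldr_mat_carrier:
  fixes U :: "'e \<Rightarrow> complex mat"
  assumes "\<And>e. e \<in> arcs G \<Longrightarrow> U e \<in> carrier_mat (n (tail G e)) (n (head G e))"
    and "set es \<subseteq> arcs G" "pre_digraph.cas G u es v" "M \<in> carrier_mat (n v) k"
  shows "foldr (\<lambda>e M. U e * M) es M \<in> carrier_mat (n u) k
    \<and> foldr (\<lambda>e M. U e * M) es M = foldr (\<lambda>e M. U e * M) es (1\<^sub>m (n v)) * M
    \<and> foldr (\<lambda>e M. U e * M) es (1\<^sub>m (n v)) \<in> carrier_mat (n u) (n v)"
  using assms(2-4)
proof (induction es arbitrary: u)
  case Nil
  then have "u = v" by (simp add: pre_digraph.cas.simps)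
  with Nil(3) show ?case by (simp add: left_mult_one_mat[of M "n v" k])
next
  case (Cons e es)
  from Cons.prems have e: "tail G e = u" "pre_digraph.cas G (head G e) es v" "e \<in> arcs G"
    by (auto simp: pre_digraph.cas.simps)
  have Ue: "U e \<in> carrier_mat (n u) (n (head G e))" using assms(1)[OF e(3)] e(1) by simp
  note IH = Cons.IH[OF _ e(2) Cons.prems(3)]
  show ?case using IH Ue Cons.prems(1,3)
    by (auto intro!: assoc_mult_mat[symmetric])
qed

lemma cycle_det_rotate1:
  assumes U: "\<And>e. e \<in> arcs G \<Longrightarrow> U e \<in> carrier_mat (n (tail G e)) (n (head G e))"
    and wf: "wf_digraph G" and es: "wf_digraph.closed_w G es"
  shows "cycle_det G n q U (rotate1 es) = cycle_det G n q U es"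
proof -
  from es obtain u where u: "set es \<subseteq> arcs G" "pre_digraph.cas G u es u" "es \<noteq> []"
    by (auto simp: wf_digraph.closed_w_def[OF wf] pre_digraph.awalk_def)
  then obtain e fs where fs: "es = e # fs" by (cases es) auto
  let ?w = "head G e"
  let ?F = "foldr (\<lambda>e M. U e * M) fs (1\<^sub>m (n u))"
  let ?a = "complex_of_real (\<Prod>e\<leftarrow>es. q e)"
  from u fs have e: "tail G e = u" "pre_digraph.cas G ?w fs u" "e \<in> arcs G" "set fs \<subseteq> arcs G"
    by (auto simp: pre_digraph.cas.simps)
  have Ue: "U e \<in> carrier_mat (n u) (n ?w)" using U[OF e(3)] e(1) by simp
  have F: "?F \<in> carrier_mat (n ?w) (n u)"
    using foldr_mat_carrier[OF U e(4,2) one_carrier_mat] by blast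
  have hd_es: "tail G (hd es) = u" using fs e by simp
  have w: "tail G (hd (rotate1 es)) = ?w"
    using fs e by (cases fs) (auto simp: pre_digraph.cas.simps)
  have "holonomy G n U (rotate1 es) = foldr (\<lambda>e M. U e * M) fs (U e)"
    using Ue fs w by (simp add: holonomy_def)
  also have "\<dots> = ?F * U e"
    using foldr_mat_carrier[OF U e(4,2) Ue] by blast
  finally have h1: "holonomy G n U (rotate1 es) = ?F * U e" .
  have h2: "holonomy G n U es = U e * ?F"
    using fs e by (simp add: holonomy_def)
  have p: "(\<Prod>e\<leftarrow>rotate1 es. q e) = (\<Prod>e\<leftarrow>es. q e)"
    by (simp add: fs mult.commute)
  have "cycle_det G n q U es = det (1\<^sub>m (n u) - (?a \<cdot>\<^sub>m U e) * ?F)"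
    unfolding cycle_det_def h2 hd_es by (simp only: mult_smult_assoc_mat[OF Ue F])
  also have "\<dots> = det (1\<^sub>m (n ?w) - ?F * (?a \<cdot>\<^sub>m U e))"
    using Ue F by (intro det_one_minus_mult_commute) auto
  also have "\<dots> = cycle_det G n q U (rotate1 es)"
    unfolding cycle_det_def h1 w p by (simp only: mult_smult_distrib[OF F Ue])
  finally show ?thesis by simp
qed

lemma closed_w_rotate1:
  assumes "wf_digraph G" "wf_digraph.closed_w G es"
  shows "wf_digraph.closed_w G (rotate1 es)"
proof -
  interpret wf_digraph G by fact
  show ?thesis using assms(2)
    by (cases es) (auto simp: closed_w_def awalk_Cons_iff awalk_Nil_iff intro!: exI awalk_appendI)
qed

lemma cycle_det_cycle_rep:
  assumes wf: "wf_digraph G"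
    and U: "\<And>e. e \<in> arcs G \<Longrightarrow> U e \<in> carrier_mat (n (tail G e)) (n (head G e))"
    and c: "c \<in> cycles G" "es \<in> c"
  shows "cycle_det G n q U (cycle_rep c) = cycle_det G n q U es"
proof -
  have es: "wf_digraph.closed_w G es"
    using c in_quotient_imp_subset[OF equiv_cycle_rel] by (fastforce simp: cycles_def)
  obtain k where k: "cycle_rep c = rotate k es" using cycle_rep_rotate[OF c] .
  have "wf_digraph.closed_w G (rotate k es)
    \<and> cycle_det G n q U (rotate k es) = cycle_det G n q U es"
    by (induction k) (auto simp: es closed_w_rotate1[OF wf] cycle_det_rotate1[where U = U, OF U wf])
  then show ?thesis by (simp add: k)
qed

end

theory Submission
  imports
    Defs
    "HOL-Computational_Algebra.Polynomial_FPS"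
    "Jordan_Normal_Form.Schur_Decomposition"
begin

text \<open>
  Let \<open>M\<^sub>e\<close> be the endomorphism of the direct sum whose only nonzero block is \<open>p\<^sub>e U\<^sub>e\<close>, from the
  summand at \<open>t(e)\<close> to the summand at \<open>s(e)\<close>, and let \<open>P\<close> be the sum of all \<open>M\<^sub>e\<close>.  The Laplacian
  is \<open>I - P\<close> with the rows at each vertex \<open>a\<close> multiplied by \<open>z\<^sub>a\<close>: at a vertex with outgoing arcs
  \<open>z\<^sub>a p\<^sub>e = x\<^sub>e\<close>, and at a vertex without them both sides are zero.  This gives the factor in
  front (\<open>dsum_det_twisted_laplacian\<close>), and it remains to compute \<open>det (I - P)\<close>.

  The computation is an identity of Amitsur about arbitrary square matrices \<open>M\<^sub>e\<close>:
  \<open>det (I - \<Sum>M\<^sub>e)\<close> is the product of \<open>det (I - M\<^sub>w)\<close> over the primitive words \<open>w\<close> up to rotation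
  (\<open>amitsur_identity\<close>).  To see it, insert a variable \<open>t\<close> for each letter and take logarithms:
  \<open>- log det (I - t P)\<close> is the sum of \<open>t\<^sup>k tr (P\<^sup>k) / k\<close>, and \<open>tr (P\<^sup>k)\<close> is the sum of \<open>tr M\<^sub>w\<close> over the
  words \<open>w\<close> of length \<open>k\<close> (\<open>mat_trace_letter_sum_pow\<close>).  A nonempty word is a power \<open>u\<^sup>m\<close> of exactly
  one primitive word \<open>u\<close> (\<open>sum_words_primitive_roots\<close>), the trace does not change under rotation,
  and a primitive word of length \<open>d\<close> has \<open>d\<close> different rotations.  A rotation class of primitive
  words of length \<open>d\<close> thus contributes the sum over \<open>m\<close> of \<open>d t\<^sup>d\<^sup>m tr (M\<^sub>u\<^sup>m) / (d m)\<close>, which is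
  \<open>- log det (I - t\<^sup>d M\<^sub>u)\<close>.  When only finitely many classes contribute, both sides are polynomials
  in \<open>t\<close>, and \<open>t = 1\<close> can be substituted.

  In the present situation \<open>M\<^sub>w\<close> is zero unless \<open>w\<close> is a walk, and for a walk from \<open>u\<close> to \<open>v\<close> it has
  the scaled holonomy of \<open>w\<close> as its only block, in position \<open>(u, v)\<close>
  (\<open>word_mat_transition_block\<close>).  So for a closed walk \<open>det (I - M\<^sub>w)\<close> is the factor of the
  corresponding cycle, while all powers of a word that is not a closed walk have trace zero and
  do not contribute.  Hence exactly the prime cycles remain, and by assumption there are finitely
  many of them.
\<close>

section \<open>Products determined by power sums\<close>

text \<open>
  The coefficient of index \<open>k > 0\<close> in the differential equation \<open>X F' = F h\<close> determines the \<open>k\<close>-th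
  coefficient of \<open>F\<close> from the earlier ones, because \<open>h\<close> has no constant term.
\<close>

lemma fps_eq_if_same_log_deriv:
  fixes F G h :: "'a::{idom, ring_char_0} fps"
  assumes F: "fps_X * fps_deriv F = F * h" and G: "fps_X * fps_deriv G = G * h"
    and h: "fps_nth h 0 = 0" and eq0: "fps_nth F 0 = fps_nth G 0"
  shows "F = G"
proof -
  let ?D = "F - G"
  have D: "fps_X * fps_deriv ?D = ?D * h"
    using F G by (simp add: algebra_simps)
  have "fps_nth ?D k = 0" for k
  proof (induction k rule: less_induct)
    case (less k)
    show ?case
    proof (cases "k = 0")
      case False
      have "of_nat k * fps_nth ?D k = fps_nth (fps_X * fps_deriv ?D) k"
        using False by (simp add: algebra_simps)
      also have "\<dots> = (\<Sum>i=0..k. fps_nth ?D i * fps_nth h (k - i))"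
        unfolding D by (simp add: fps_mult_nth)
      also have "\<dots> = 0"
      proof (rule sum.neutral, rule ballI)
        fix i assume "i \<in> {0..k}"
        then show "fps_nth ?D i * fps_nth h (k - i) = 0"
          using less.IH[of i] h by (cases "i = k") auto
      qed
      finally show ?thesis using False by simp
    qed (use eq0 in simp)
  qed
  then show ?thesis by (metis eq_iff_diff_eq_0 fps_ext fps_zero_nth)
qed

text \<open>
  This is \<open>X F' / F\<close> for the product \<open>F\<close> of the factors \<open>1 - a X\<^sup>d\<close>; the factor \<open>X\<close> makes the
  coefficient of index \<open>k\<close> the weighted power sum of order \<open>k\<close>.
\<close>

definition log_deriv :: "('a::comm_ring_1 \<times> nat) list \<Rightarrow> 'a fps" where
  "log_deriv xs = Abs_fps (\<lambda>k. if k = 0 then 0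
     else - (\<Sum>(a, d)\<leftarrow>xs. if d dvd k then of_nat d * a ^ (k div d) else 0))"

lemma fps_X_deriv_binomial:
  fixes a :: "'a::comm_ring_1"
  assumes "d > 0"
  shows "fps_X * fps_deriv (1 - fps_const a * fps_X ^ d) =
    (1 - fps_const a * fps_X ^ d) * log_deriv [(a, d)]"
proof (rule fps_ext)
  fix k
  let ?g = "log_deriv [(a, d)]"
  have "fps_nth ((1 - fps_const a * fps_X ^ d) * ?g) k
      = fps_nth ?g k - a * (if k < d then 0 else fps_nth ?g (k - d))"
    by (simp add: left_diff_distrib mult.assoc fps_X_power_mult_nth)
  also have "\<dots> = (if k = d then - (of_nat d * a) else 0)"
  proof (cases "k > d \<and> d dvd k")
    case True
    then have "k div d = Suc ((k - d) div d)" "d dvd k - d"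
      using assms by (auto simp: le_div_geq)
    then show ?thesis using True by (auto simp: log_deriv_def algebra_simps)
  next
    case False
    then show ?thesis using assms
      by (auto simp: log_deriv_def dvd_minus_self dest: dvd_imp_le)
  qed
  also have "\<dots> = fps_nth (fps_X * fps_deriv (1 - fps_const a * fps_X ^ d)) k"
    using assms by (auto simp: fps_X_power_iff fps_deriv_nth)
  finally show "fps_nth (fps_X * fps_deriv (1 - fps_const a * fps_X ^ d)) k =
      fps_nth ((1 - fps_const a * fps_X ^ d) * ?g) k" by simp
qed

lemma log_deriv_Cons: "log_deriv (p # xs) = log_deriv [p] + log_deriv xs"
  by (rule fps_ext) (simp add: log_deriv_def split: prod.split)

lemma fps_X_deriv_prod_binomials:
  fixes xs :: "('a::comm_ring_1 \<times> nat) list"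
  assumes "\<And>a d. (a, d) \<in> set xs \<Longrightarrow> d > 0"
  shows "fps_X * fps_deriv (\<Prod>(a, d)\<leftarrow>xs. 1 - fps_const a * fps_X ^ d) =
    (\<Prod>(a, d)\<leftarrow>xs. 1 - fps_const a * fps_X ^ d) * log_deriv xs"
  using assms
proof (induction xs)
  case Nil
  then show ?case by (simp add: log_deriv_def fps_eq_iff)
next
  case (Cons p xs)
  obtain a d where p: "p = (a, d)" by (cases p)
  let ?B = "1 - fps_const a * fps_X ^ d"
  let ?F = "\<Prod>(a, d)\<leftarrow>xs. 1 - fps_const a * fps_X ^ d"
  have IH: "fps_X * fps_deriv ?F = ?F * log_deriv xs"
    using Cons by auto
  have B: "fps_X * fps_deriv ?B = ?B * log_deriv [p]"
    unfolding p using Cons.prems[of a d] by (intro fps_X_deriv_binomial) (simp add: p)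
  have "fps_X * fps_deriv (?B * ?F) = ?B * (fps_X * fps_deriv ?F) + (fps_X * fps_deriv ?B) * ?F"
    by (simp only: fps_deriv_mult distrib_left ac_simps)
  also have "\<dots> = (?B * ?F) * log_deriv (p # xs)"
    unfolding IH B log_deriv_Cons[of p xs] by (simp only: distrib_left distrib_right ac_simps)
  finally show ?case by (simp add: p)
qed

text \<open>
  Newton's relation between power sums and elementary symmetric functions: equal power sums force
  the polynomials \<open>\<Prod>(1 - a X\<^sup>d)\<close> to have the same logarithmic derivative, hence to be equal, and the
  claim is their value at \<open>1\<close>.  Over an algebraic closure,
  \<open>1 - a X\<^sup>d\<close> is the product of \<open>1 - b X\<close> over the \<open>d\<close>-th
  roots \<open>b\<close> of \<open>a\<close>, and \<open>d a^(k/d)\<close> or \<open>0\<close> is the power sum of these roots.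
\<close>

lemma prod_one_minus_eq_if_power_sums_eq:
  fixes xs ys :: "('a::field_char_0 \<times> nat) list"
  assumes pos: "\<And>a d. (a, d) \<in> set xs \<union> set ys \<Longrightarrow> d > 0"
    and eq: "\<And>k. k > 0 \<Longrightarrow>
      (\<Sum>(a, d)\<leftarrow>xs. if d dvd k then of_nat d * a ^ (k div d) else 0) =
      (\<Sum>(a, d)\<leftarrow>ys. if d dvd k then of_nat d * a ^ (k div d) else 0)"
  shows "(\<Prod>(a, d)\<leftarrow>xs. 1 - a) = (\<Prod>(a, d)\<leftarrow>ys. 1 - a)"
proof -
  define F :: "('a \<times> nat) list \<Rightarrow> 'a fps"
    where "F = (\<lambda>xs. \<Prod>(a, d)\<leftarrow>xs. 1 - fps_const a * fps_X ^ d)"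
  define p :: "('a \<times> nat) list \<Rightarrow> 'a poly"
    where "p = (\<lambda>xs. \<Prod>(a, d)\<leftarrow>xs. 1 - monom a d)"
  have F_p: "F zs = fps_of_poly (p zs)" for zs
    by (induction zs) (auto simp: F_def p_def fps_of_poly_mult fps_of_poly_diff fps_of_poly_monom)
  have p_1: "poly (p zs) 1 = (\<Prod>(a, d)\<leftarrow>zs. 1 - a)" for zs
    by (induction zs) (auto simp: p_def poly_monom)
  have F_0: "fps_nth (F zs) 0 = 1" if "\<And>a d. (a, d) \<in> set zs \<Longrightarrow> d > 0" for zs
    using that
  proof (induction zs)
    case (Cons z zs)
    then have "fps_nth (F zs) 0 = 1" "snd z > 0" by (cases z; auto)+
    then show ?case by (cases z) (simp add: F_def)
  qed (simp add: F_def)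
  have log_eq: "log_deriv xs = log_deriv ys"
    using eq by (simp add: log_deriv_def fps_eq_iff)
  have "F xs = F ys"
  proof (rule fps_eq_if_same_log_deriv)
    show "fps_X * fps_deriv (F xs) = F xs * log_deriv ys"
      unfolding F_def log_eq[symmetric] by (rule fps_X_deriv_prod_binomials) (use pos in auto)
    show "fps_X * fps_deriv (F ys) = F ys * log_deriv ys"
      unfolding F_def by (rule fps_X_deriv_prod_binomials) (use pos in auto)
    show "fps_nth (F xs) 0 = fps_nth (F ys) 0"
      by (rule trans[OF F_0 F_0[symmetric]]) (use pos in auto)
  qed (simp add: log_deriv_def)
  then have "p xs = p ys" by (simp add: F_p)
  then show ?thesis by (metis p_1)
qed

section \<open>Traces and eigenvalues\<close>

definition mat_trace :: "'a::comm_monoid_add mat \<Rightarrow> 'a" where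
  "mat_trace A = (\<Sum>i<dim_row A. A $$ (i, i))"

lemma mat_trace_mult_commute:
  fixes A B :: "'a::comm_semiring_0 mat"
  assumes "A \<in> carrier_mat n m" "B \<in> carrier_mat m n"
  shows "mat_trace (A * B) = mat_trace (B * A)"
proof -
  have "mat_trace (A * B) = (\<Sum>i<n. \<Sum>j<m. A $$ (i, j) * B $$ (j, i))"
    using assms by (auto simp: mat_trace_def scalar_prod_def atLeast0LessThan intro!: sum.cong)
  also have "\<dots> = (\<Sum>j<m. \<Sum>i<n. B $$ (j, i) * A $$ (i, j))"
    by (subst sum.swap) (simp add: mult.commute)
  also have "\<dots> = mat_trace (B * A)"
    using assms by (auto simp: mat_trace_def scalar_prod_def atLeast0LessThan intro!: sum.cong)
  finally show ?thesis .
qed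

lemma upper_triangular_pow:
  fixes B :: "'a::comm_semiring_1 mat"
  assumes B: "B \<in> carrier_mat n n" "upper_triangular B"
  shows "upper_triangular (B ^\<^sub>m k) \<and> (\<forall>i<n. (B ^\<^sub>m k) $$ (i, i) = B $$ (i, i) ^ k)"
proof (induction k)
  case 0
  show ?case using B by (auto simp: upper_triangular_def)
next
  case (Suc k)
  let ?C = "B ^\<^sub>m k"
  have C: "?C \<in> carrier_mat n n" using B by simp
  have entry: "(?C * B) $$ (i, j) = (\<Sum>l<n. ?C $$ (i, l) * B $$ (l, j))" if "i < n" "j < n" for i j
    using that B C by (simp add: scalar_prod_def atLeast0LessThan)
  have zC: "?C $$ (i, l) = 0" if "l < i" "i < n" for i l
    using that Suc C B by (auto simp: upper_triangular_def)
  have zB: "B $$ (i, l) = 0" if "l < i" "i < n" for i l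
    using that B by (auto simp: upper_triangular_def)
  have lower: "(?C * B) $$ (i, j) = 0" if ji: "j < i" "i < n" for i j
  proof -
    have "?C $$ (i, l) * B $$ (l, j) = 0" if "l < n" for l
      using zC[of l i] zB[of j l] ji that by (cases "l < i") auto
    then show ?thesis using ji by (simp add: entry)
  qed
  have diag: "(?C * B) $$ (i, i) = B $$ (i, i) ^ Suc k" if i: "i < n" for i
  proof -
    have "(?C * B) $$ (i, i) = (\<Sum>l<n. if l = i then ?C $$ (i, i) * B $$ (i, i) else 0)"
      unfolding entry[OF i i]
    proof (rule sum.cong)
      fix l assume "l \<in> {..<n}"
      then show "?C $$ (i, l) * B $$ (l, i) = (if l = i then ?C $$ (i, i) * B $$ (i, i) else 0)"
        using zC[of l i] zB[of i l] i by (cases l i rule: linorder_cases) auto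
    qed simp
    then show ?thesis using i Suc by (simp add: mult.commute)
  qed
  show ?case using lower diag B C by (auto simp: upper_triangular_def simp del: index_mult_mat(1))
qed

text \<open>
  The list consists of the eigenvalues with multiplicity.  They are read off the diagonal of a
  triangular matrix \<open>B\<close> with \<open>A = P B Q\<close>; moving \<open>P\<close> to the other end, where it cancels \<open>Q\<close>, changes
  neither the determinant nor the trace.
\<close>

lemma eigenvalue_list_exists:
  fixes A :: "complex mat"
  assumes A: "A \<in> carrier_mat n n"
  obtains ls where "det (1\<^sub>m n - A) = (\<Prod>l\<leftarrow>ls. 1 - l)"
    and "\<And>k. mat_trace (A ^\<^sub>m k) = (\<Sum>l\<leftarrow>ls. l ^ k)"
proof -
  obtain es where es: "char_poly A = (\<Prod>a\<leftarrow>es. [:- a, 1:])"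
    using char_poly_factorized[OF A] by blast
  obtain B P Q where "schur_decomposition A es = (B, P, Q)" by (cases "schur_decomposition A es")
  from schur_decomposition[OF A es this]
  have sim: "similar_mat_wit A B P Q" and up: "upper_triangular B" by auto
  from similar_mat_witD2[OF A sim]
  have A_eq: "A = P * B * Q" and QP: "Q * P = 1\<^sub>m n"
    and B: "B \<in> carrier_mat n n" and P: "P \<in> carrier_mat n n" and Q: "Q \<in> carrier_mat n n"
    by auto
  let ?ls = "diag_mat B"
  \<comment> \<open>With \<open>conj\<close>, both invariants see \<open>P * (X * Q)\<close> as \<open>(X * Q) * P = X\<close>.\<close>
  have conj: "P * X * Q = P * (X * Q)" "X * Q * P = X" if X: "X \<in> carrier_mat n n" for X
    using assoc_mult_mat[OF P X Q] assoc_mult_mat[OF X Q P] QP X by auto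
  have "det (1\<^sub>m n - A) = det (1\<^sub>m n - P * (B * Q))"
    using A_eq conj(1)[OF B] by simp
  also have "\<dots> = det (1\<^sub>m n - B)"
    using det_one_minus_mult_commute[OF P mult_carrier_mat[OF B Q]] conj(2)[OF B] by simp
  also have "\<dots> = prod_list (diag_mat (1\<^sub>m n - B))"
    using B up by (intro det_upper_triangular[of _ n]) (auto simp: upper_triangular_def)
  also have "diag_mat (1\<^sub>m n - B) = map (\<lambda>l. 1 - l) ?ls"
    using B by (auto simp: diag_mat_def)
  finally have 1: "det (1\<^sub>m n - A) = (\<Prod>l\<leftarrow>?ls. 1 - l)" .
  have 2: "mat_trace (A ^\<^sub>m k) = (\<Sum>l\<leftarrow>?ls. l ^ k)" for k
  proof -
    have Bk: "B ^\<^sub>m k \<in> carrier_mat n n" using B by simp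
    have "mat_trace (A ^\<^sub>m k) = mat_trace (P * (B ^\<^sub>m k * Q))"
      using similar_mat_wit_pow_id[OF sim, of k] conj(1)[OF Bk] by simp
    also have "\<dots> = mat_trace (B ^\<^sub>m k)"
      using mat_trace_mult_commute[OF P mult_carrier_mat[OF Bk Q]] conj(2)[OF Bk] by simp
    also have "\<dots> = (\<Sum>i<n. B $$ (i, i) ^ k)"
      using B upper_triangular_pow[OF B up, of k] by (auto simp: mat_trace_def)
    also have "\<dots> = (\<Sum>l\<leftarrow>?ls. l ^ k)"
      using B by (simp add: diag_mat_def interv_sum_list_conv_sum_set_nat atLeast0LessThan o_def)
    finally show ?thesis .
  qed
  show ?thesis using that 1 2 by blast
qed

section \<open>Primitive words\<close>

definition word_power :: "'a list \<Rightarrow> nat \<Rightarrow> 'a list" where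
  "word_power u m = concat (replicate m u)"

lemma word_power_simps [simp]:
  "word_power u 0 = []" "word_power u (Suc m) = u @ word_power u m"
  by (simp_all add: word_power_def)

lemma length_word_power [simp]: "length (word_power u m) = m * length u"
  by (induction m) auto

lemma word_power_add: "word_power u (k + m) = word_power u k @ word_power u m"
  by (induction k) auto

lemma word_power_mult: "word_power (word_power u k) m = word_power u (m * k)"
  by (induction m) (auto simp: word_power_add)

lemma word_power_append_commute: "word_power u m @ u = u @ word_power u m"
  by (induction m) auto

lemma set_word_power: "m > 0 \<Longrightarrow> set (word_power u m) = set u"
  by (induction m) (auto simp: word_power_def)

text \<open>
  Rotating a power rotates its base, as \<open>(a v)\<^sup>m\<close> with the first letter moved to the end is
  \<open>(v a)\<^sup>m\<close>.
\<close>

lemma rotate1_word_power: "rotate1 (word_power u m) = word_power (rotate1 u) m"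
proof (cases u)
  case (Cons a v)
  have shift: "word_power (v @ [a]) k @ v = v @ word_power (a # v) k" for k
    by (induction k) auto
  have "rotate1 (word_power u m) = word_power (v @ [a]) m" 
  proof (cases m)
    case (Suc k)
    have "word_power (v @ [a]) m = word_power (v @ [a]) k @ v @ [a]"
      using Suc word_power_append_commute[of "v @ [a]" k] by simp
    also have "\<dots> = (word_power (v @ [a]) k @ v) @ [a]" by simp
    also have "\<dots> = rotate1 (word_power u m)" unfolding shift using Suc Cons by simp
    finally show ?thesis by simp
  qed simp
  then show ?thesis using Cons by simp
qed (simp add: word_power_def)

lemma rotate_word_power: "rotate k (word_power u m) = word_power (rotate k u) m"
  by (induction k) (simp_all add: rotate1_word_power)

lemma rotate_inject: "rotate k u = rotate k v \<longleftrightarrow> u = v"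
  by (induction k) (auto simp: inj_eq[OF inj_rotate1])

text \<open>
  The rotations that fix a word form a group, so valuation one means that the only ones are the
  multiples of the length.
\<close>

lemma primitive_iff:
  "valuation u = 1 \<longleftrightarrow> u \<noteq> [] \<and> (\<forall>k. rotate k u = u \<longrightarrow> length u dvd k)"
proof
  assume val: "valuation u = 1"
  then have "u \<noteq> []" by (auto simp: valuation_def)
  moreover have "length u dvd k" if k: "rotate k u = u" for k
  proof -
    let ?S = "{k \<in> {0..<length u}. rotate k u = u}"
    obtain z where "?S = {z}" using val by (auto simp: valuation_def card_1_singleton_iff)
    moreover have "0 \<in> ?S" using \<open>u \<noteq> []\<close> by simp
    moreover have "k mod length u \<in> ?S" using k \<open>u \<noteq> []\<close> rotate_conv_mod[of k u] by simp
    ultimately have "k mod length u = 0" by (metis (no_types, lifting) singletonD)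
    then show ?thesis by (rule mod_0_imp_dvd)
  qed
  ultimately show "u \<noteq> [] \<and> (\<forall>k. rotate k u = u \<longrightarrow> length u dvd k)" by blast
next
  assume *: "u \<noteq> [] \<and> (\<forall>k. rotate k u = u \<longrightarrow> length u dvd k)"
  have "k = 0" if "rotate k u = u" "k < length u" for k
    using * that nat_dvd_not_less by blast
  then have "{k \<in> {0..<length u}. rotate k u = u} \<subseteq> {0}"
    unfolding atLeastLessThan_iff by blast
  moreover have "0 \<in> {k \<in> {0..<length u}. rotate k u = u}"
    using conjunct1[OF *] by simp
  ultimately have "{k \<in> {0..<length u}. rotate k u = u} = {0}" by blast
  then show "valuation u = 1" by (simp add: valuation_def)
qed

text \<open>
  If a proper rotation fixes \<open>w\<close>, then \<open>w\<close> is the concatenation of two nonempty words that commute.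
  Commuting words are powers of a common word, which is shorter than \<open>w\<close>.
\<close>

lemma primitive_root_exists:
  assumes "w \<noteq> []"
  obtains u m where "valuation u = 1" "m > 0" "w = word_power u m"
  using assms
proof (induction "length w" arbitrary: w thesis rule: less_induct)
  case less
  show ?case
  proof (cases "valuation w = 1")
    case True
    then show ?thesis using less.prems(1)[of w 1] by simp
  next
    case False
    then obtain k where k: "rotate k w = w" "\<not> length w dvd k"
      using less.prems(2) primitive_iff by metis
    define j where "j = k mod length w"
    have j: "0 < j" "j < length w"
      using k(2) less.prems(2) by (auto simp: j_def mod_eq_0_iff_dvd intro!: gr0I)
    have "take j w @ drop j w = drop j w @ take j w"
      using k(1) rotate_drop_take[of k w] by (simp add: j_def)
    from comm_append_are_replicate[OF this] obtain a b z
      where z: "word_power z a = take j w" "word_power z b = drop j w"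
      by (auto simp: word_power_def)
    have w: "w = word_power z (a + b)"
      using z by (simp add: word_power_add)
    have "length z * a > 0" "length z * b > 0"
      using j arg_cong[OF z(1), of length] arg_cong[OF z(2), of length] by (auto simp: mult.commute)
    then have ab: "a > 0" "b > 0" "length z > 0" by auto
    then have "length z < length w" by (simp add: w)
    then obtain u m where "valuation u = 1" "m > 0" "z = word_power u m"
      using less.hyps[of z] ab(3) by auto
    then show ?thesis
      using less.prems(1)[of u "(a + b) * m"] ab by (simp add: w word_power_mult)
  qed
qed

text \<open>
  The length of a primitive root divides every rotation that fixes the power.  The two lengths
  therefore divide each other, and words of the same length are equal when their powers are.
\<close>

lemma word_power_inject:
  assumes "valuation u = 1" "valuation v = 1" "m > 0" "l > 0"
    and eq: "word_power u m = word_power v l"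
  shows "u = v"
proof -
  \<comment> \<open>Rotating \<open>v\<close> by its own length fixes \<open>v\<close>, hence its powers, hence \<open>u\<close>.\<close>
  have dvd: "length u dvd length v"
    if prim: "valuation u = 1" and "m > 0" and e: "word_power u m = word_power v l"
    for u v :: "'a list" and m l
  proof -
    have rot: "rotate (length v) v = v" by simp
    have "word_power (rotate (length v) u) m = word_power u m"
      using rotate_word_power[of "length v" v l] unfolding rot e[symmetric] rotate_word_power .
    then have "rotate (length v) u = u"
      using \<open>m > 0\<close> by (cases m) auto
    then show ?thesis using prim primitive_iff by blast
  qed
  have len: "length u = length v"
    using dvd[OF assms(1,3) eq] dvd[OF assms(2,4) eq[symmetric]] by (rule dvd_antisym)
  obtain m' l' where "m = Suc m'" "l = Suc l'" using assms(3,4) by (metis gr0_implies_Suc)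
  then show ?thesis using eq len by simp
qed

lemma card_rotations_primitive:
  assumes prim: "valuation u = 1"
  shows "finite (range (\<lambda>k. rotate k u))" "card (range (\<lambda>k. rotate k u)) = length u"
proof -
  have ne: "u \<noteq> []" using prim primitive_iff by blast
  have rng: "range (\<lambda>k. rotate k u) = (\<lambda>k. rotate k u) ` {..<length u}"
  proof (safe)
    fix k
    show "rotate k u \<in> (\<lambda>k. rotate k u) ` {..<length u}"
      using ne by (intro image_eqI[of _ _ "k mod length u"]) (auto simp: rotate_conv_mod[of k])
  qed auto
  have le: "i = j" if "rotate i u = rotate j u" "j < length u" "i \<le> j" for i j
  proof -
    have "rotate i (rotate (j - i) u) = rotate i u"
      using that by (simp add: rotate_rotate)
    then have "length u dvd j - i"
      using prim unfolding rotate_inject primitive_iff by blast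
    then show "i = j" using that by (auto dest!: dvd_imp_le)
  qed
  have "inj_on (\<lambda>k. rotate k u) {..<length u}"
    by (rule inj_onI) (metis le lessThan_iff nat_le_linear)
  then show "card (range (\<lambda>k. rotate k u)) = length u" "finite (range (\<lambda>k. rotate k u))"
    unfolding rng by (simp_all add: card_image)
qed

text \<open>
  A primitive word whose length divides \<open>k\<close> has one power of length \<open>k\<close>, and every word of length
  \<open>k\<close> arises from exactly one primitive word in this way.
\<close>

lemma sum_words_primitive_roots:
  fixes f :: "'a list \<Rightarrow> 'b::comm_monoid_add"
  assumes k: "k > 0"
  shows "(\<Sum>w | set w \<subseteq> A \<and> length w = k. f w) =
    (\<Sum>u | set u \<subseteq> A \<and> valuation u = 1 \<and> length u dvd k. f (word_power u (k div length u)))"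
    (is "sum f ?W = sum ?g ?P")
proof -
  let ?h = "\<lambda>u. word_power u (k div length u)"
  have quot: "k div length u > 0 \<and> k div length u * length u = k" if "u \<in> ?P" for u
    using that k by (auto simp: div_greater_zero_iff dest: dvd_imp_le dvd_pos_nat)
  have "inj_on ?h ?P"
  proof (rule inj_onI)
    fix u v assume uv: "u \<in> ?P" "v \<in> ?P" "?h u = ?h v"
    then show "u = v"
      using word_power_inject[of u v] quot[of u] quot[of v] by blast
  qed
  moreover have "?h ` ?P = ?W"
  proof (rule subset_antisym)
    show "?h ` ?P \<subseteq> ?W"
    proof (rule image_subsetI)
      fix u assume "u \<in> ?P"
      then show "?h u \<in> ?W" using quot[of u] by (auto simp: set_word_power)
    qed
  next
    show "?W \<subseteq> ?h ` ?P"
    proof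
      fix w assume w: "w \<in> ?W"
      then have "w \<noteq> []" using k by auto
      then obtain u m where u: "valuation u = 1" "m > 0" "w = word_power u m"
        using primitive_root_exists by blast
      then have "k = m * length u" "length u > 0" using w primitive_iff by auto
      with u w show "w \<in> ?h ` ?P"
        by (intro image_eqI[of _ _ u]) (auto simp: set_word_power)
    qed
  qed
  ultimately show ?thesis by (subst sum.reindex_cong[of ?h ?P]) auto
qed

section \<open>Products of matrices along words\<close>

definition word_mat :: "nat \<Rightarrow> ('e \<Rightarrow> 'a::semiring_1 mat) \<Rightarrow> 'e list \<Rightarrow> 'a mat" where
  "word_mat N M w = foldr (\<lambda>e X. M e * X) w (1\<^sub>m N)"

definition letter_sum :: "nat \<Rightarrow> ('e \<Rightarrow> 'a::semiring_1 mat) \<Rightarrow> 'e set \<Rightarrow> 'a mat" where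
  "letter_sum N M A = mat N N (\<lambda>ij. \<Sum>e\<in>A. M e $$ ij)"

lemma letter_sum_carrier [simp]: "letter_sum N M A \<in> carrier_mat N N"
  by (simp add: letter_sum_def)

lemma word_mat_carrier:
  assumes M: "M \<in> A \<rightarrow> carrier_mat N N" and "set w \<subseteq> A"
  shows "word_mat N M w \<in> carrier_mat N N"
  using assms(2) by (induction w) (auto simp: word_mat_def intro!: mult_carrier_mat funcset_mem[OF M])

lemma word_mat_Cons: "word_mat N M (e # w) = M e * word_mat N M w"
  by (simp add: word_mat_def)

lemma word_mat_append:
  fixes M :: "'e \<Rightarrow> 'a::comm_semiring_1 mat"
  assumes M: "M \<in> A \<rightarrow> carrier_mat N N" and "set v \<subseteq> A" "set w \<subseteq> A"
  shows "word_mat N M (v @ w) = word_mat N M v * word_mat N M w"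
  using assms(2)
proof (induction v)
  case Nil
  then show ?case using word_mat_carrier[OF M assms(3)] by (simp add: word_mat_def)
next
  case (Cons e v)
  then show ?case
    using assoc_mult_mat[OF funcset_mem[OF M, of e] word_mat_carrier[OF M, of v] word_mat_carrier[OF M assms(3)]]
    by (simp add: word_mat_Cons)
qed

lemma word_mat_word_power:
  fixes M :: "'e \<Rightarrow> 'a::comm_semiring_1 mat"
  assumes M: "M \<in> A \<rightarrow> carrier_mat N N" and u: "set u \<subseteq> A"
  shows "word_mat N M (word_power u m) = word_mat N M u ^\<^sub>m m"
proof (induction m)
  case 0
  show ?case using word_mat_carrier[OF M u] by (simp add: word_mat_def)
next
  case (Suc m)
  have "set (word_power u m) \<subseteq> A" using u by (auto simp: word_power_def)
  then show ?case
    using Suc u word_power_append_commute[of u m] word_mat_append[OF M, of "word_power u m" u] by simp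
qed

lemma mat_trace_word_mat_rotate:
  fixes M :: "'e \<Rightarrow> 'a::comm_semiring_1 mat"
  assumes M: "M \<in> A \<rightarrow> carrier_mat N N" and w: "set w \<subseteq> A"
  shows "mat_trace (word_mat N M (rotate k w)) = mat_trace (word_mat N M w)"
proof -
  let ?v = "take (k mod length w) w" and ?v' = "drop (k mod length w) w"
  have sub: "set ?v \<subseteq> A" "set ?v' \<subseteq> A"
    using w set_take_subset set_drop_subset by (metis order_trans)+
  have "mat_trace (word_mat N M (rotate k w)) = mat_trace (word_mat N M ?v' * word_mat N M ?v)"
    using sub by (simp add: rotate_drop_take word_mat_append[OF M])
  also have "\<dots> = mat_trace (word_mat N M ?v * word_mat N M ?v')"
    by (rule mat_trace_mult_commute[OF word_mat_carrier[OF M sub(2)] word_mat_carrier[OF M sub(1)]])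
  also have "\<dots> = mat_trace (word_mat N M w)"
    using sub by (simp flip: word_mat_append[OF M])
  finally show ?thesis .
qed

text \<open>
  Expanding the power of the sum of the letters gives one product for each word.  The induction
  splits off the first letter, in accordance with \<^const>\<open>word_mat\<close>.
\<close>

lemma letter_sum_pow_index:
  fixes M :: "'e \<Rightarrow> 'a::comm_semiring_1 mat"
  assumes M: "M \<in> A \<rightarrow> carrier_mat N N" and A: "finite A" and ij: "i < N" "j < N"
  shows "(letter_sum N M A ^\<^sub>m k) $$ (i, j) =
    (\<Sum>w | set w \<subseteq> A \<and> length w = k. word_mat N M w $$ (i, j))"
  using ij(1)
proof (induction k arbitrary: i)
  case 0
  have "{w. set w \<subseteq> A \<and> length w = 0} = {[]}" by auto
  then show ?case using 0 ij by (simp add: word_mat_def letter_sum_def)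
next
  case (Suc k)
  let ?P = "letter_sum N M A" and ?W = "{w. set w \<subseteq> A \<and> length w = k}"
  have P: "?P \<in> carrier_mat N N" by simp
  have com: "?P ^\<^sub>m Suc k = ?P * ?P ^\<^sub>m k"
  proof (induction k)
    case (Suc k)
    then show ?case
      using assoc_mult_mat[OF P pow_carrier_mat[OF P, of k] P] by simp
  qed (simp add: letter_sum_def)
  have entry: "(M e * word_mat N M w) $$ (i, j) = (\<Sum>l<N. M e $$ (i, l) * word_mat N M w $$ (l, j))"
    if "e \<in> A" "set w \<subseteq> A" for e w
    using funcset_mem[OF M that(1)] word_mat_carrier[OF M that(2)] Suc.prems ij(2)
    by (simp add: scalar_prod_def atLeast0LessThan)
  have "(?P ^\<^sub>m Suc k) $$ (i, j) = (\<Sum>l<N. ?P $$ (i, l) * (?P ^\<^sub>m k) $$ (l, j))"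
    unfolding com using Suc.prems ij(2) by (simp add: scalar_prod_def atLeast0LessThan letter_sum_def)
  also have "\<dots> = (\<Sum>l<N. (\<Sum>e\<in>A. M e $$ (i, l)) * (\<Sum>w\<in>?W. word_mat N M w $$ (l, j)))"
    using Suc by (intro sum.cong) (auto simp: letter_sum_def)
  also have "\<dots> = (\<Sum>l<N. \<Sum>(w, e)\<in>?W \<times> A. M e $$ (i, l) * word_mat N M w $$ (l, j))"
    by (simp add: sum_product sum.cartesian_product[symmetric] sum.swap[of _ A])
  also have "\<dots> = (\<Sum>(w, e)\<in>?W \<times> A. \<Sum>l<N. M e $$ (i, l) * word_mat N M w $$ (l, j))"
    by (subst sum.swap) (simp add: case_prod_unfold)
  also have "\<dots> = (\<Sum>(w, e)\<in>?W \<times> A. word_mat N M (e # w) $$ (i, j))"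
    by (intro sum.cong) (auto simp: entry word_mat_Cons)
  also have "\<dots> = (\<Sum>w | set w \<subseteq> A \<and> length w = Suc k. word_mat N M w $$ (i, j))"
    unfolding lists_length_Suc_eq
    by (subst sum.reindex) (auto simp: inj_on_def case_prod_unfold)
  finally show ?case .
qed

lemma mat_trace_letter_sum_pow:
  fixes M :: "'e \<Rightarrow> 'a::comm_semiring_1 mat"
  assumes M: "M \<in> A \<rightarrow> carrier_mat N N" and A: "finite A"
  shows "mat_trace (letter_sum N M A ^\<^sub>m k) =
    (\<Sum>w | set w \<subseteq> A \<and> length w = k. mat_trace (word_mat N M w))"
proof -
  let ?W = "{w. set w \<subseteq> A \<and> length w = k}"
  have "mat_trace (letter_sum N M A ^\<^sub>m k) = (\<Sum>i<N. \<Sum>w\<in>?W. word_mat N M w $$ (i, i))"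
    unfolding mat_trace_def pow_mat_dim_square(1)[OF letter_sum_carrier]
    by (simp add: letter_sum_pow_index[OF M A])
  also have "\<dots> = (\<Sum>w\<in>?W. \<Sum>i<N. word_mat N M w $$ (i, i))"
    by (rule sum.swap)
  also have "\<dots> = (\<Sum>w\<in>?W. mat_trace (word_mat N M w))"
    by (intro sum.cong) (auto simp: mat_trace_def carrier_matD(1)[OF word_mat_carrier[OF M]])
  finally show ?thesis .
qed

section \<open>The identity of Amitsur\<close>

text \<open>
  The set \<open>C\<close> consists of rotation classes of primitive words and contains all classes that matter:
  a primitive word outside contributes nothing to any \<open>tr (P\<^sup>k)\<close>.  By
  \<open>prod_one_minus_eq_if_power_sums_eq\<close> it suffices to compare the power sums of the
  eigenvalues of \<open>P\<close> with those of the eigenvalues of the matrices of the classes, where an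
  eigenvalue that belongs to a class of words of length \<open>d\<close> carries the weight \<open>d\<close>.
\<close>

lemma amitsur_identity:
  fixes M :: "'e \<Rightarrow> complex mat"
  assumes A: "finite A" and M: "M \<in> A \<rightarrow> carrier_mat N N"
    and C: "finite C" and r: "\<And>c. c \<in> C \<Longrightarrow> r c \<in> c"
    and prim: "\<And>c u. c \<in> C \<Longrightarrow> u \<in> c \<Longrightarrow> set u \<subseteq> A \<and> valuation u = 1"
    and cls: "\<And>c u. c \<in> C \<Longrightarrow> u \<in> c \<Longrightarrow> c = range (\<lambda>k. rotate k u)"
    and vanish: "\<And>u m. set u \<subseteq> A \<Longrightarrow> valuation u = 1 \<Longrightarrow> u \<notin> \<Union>C \<Longrightarrow> m > 0 \<Longrightarrow>
      mat_trace (word_mat N M (word_power u m)) = 0"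
  shows "det (1\<^sub>m N - letter_sum N M A) = (\<Prod>c\<in>C. det (1\<^sub>m N - word_mat N M (r c)))"
proof -
  let ?P = "letter_sum N M A"
  obtain ms where ms: "det (1\<^sub>m N - ?P) = (\<Prod>l\<leftarrow>ms. 1 - l)"
      "\<And>k. mat_trace (?P ^\<^sub>m k) = (\<Sum>l\<leftarrow>ms. l ^ k)"
    using eigenvalue_list_exists[OF letter_sum_carrier] by blast
  have r_sub: "set (r c) \<subseteq> A" and r_prim: "valuation (r c) = 1" and r_ne: "length (r c) > 0"
    if "c \<in> C" for c
    using prim[OF that r[OF that]] primitive_iff by auto
  have "\<exists>ls. det (1\<^sub>m N - word_mat N M (r c)) = (\<Prod>l\<leftarrow>ls. 1 - l) \<and>
      (\<forall>k. mat_trace (word_mat N M (r c) ^\<^sub>m k) = (\<Sum>l\<leftarrow>ls. l ^ k))" if "c \<in> C" for c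
  proof -
    have "word_mat N M (r c) \<in> carrier_mat N N"
      by (rule word_mat_carrier[OF M r_sub[OF that]])
    then show ?thesis by (rule eigenvalue_list_exists) blast
  qed
  then obtain ls where ls: "\<And>c. c \<in> C \<Longrightarrow> det (1\<^sub>m N - word_mat N M (r c)) = (\<Prod>l\<leftarrow>ls c. 1 - l)"
      "\<And>c k. c \<in> C \<Longrightarrow> mat_trace (word_mat N M (r c) ^\<^sub>m k) = (\<Sum>l\<leftarrow>ls c. l ^ k)"
    by metis
  obtain cs where cs: "set cs = C" "distinct cs" using C finite_distinct_list by blast
  define xs where "xs = map (\<lambda>l. (l, 1::nat)) ms"
  define ys where "ys = concat (map (\<lambda>c. map (\<lambda>l. (l, length (r c))) (ls c)) cs)"
  have "(\<Prod>(a, d)\<leftarrow>xs. 1 - a) = (\<Prod>(a, d)\<leftarrow>ys. 1 - a)"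
  proof (rule prod_one_minus_eq_if_power_sums_eq)
    show "d > 0" if "(a, d) \<in> set xs \<union> set ys" for a d
      using that r_ne cs(1) by (auto simp: xs_def ys_def)
  next
    fix k :: nat assume k: "k > 0"
    let ?tr = "\<lambda>u. mat_trace (word_mat N M (word_power u (k div length u)))"
    let ?Q = "{u. set u \<subseteq> A \<and> valuation u = 1 \<and> length u dvd k}"
    have fin: "finite c" and card: "card c = length (r c)" if "c \<in> C" for c
      using card_rotations_primitive[OF r_prim[OF that]] cls[OF that r[OF that]] by simp_all
    have disj: "c = c'" if "c \<in> C" "c' \<in> C" "u \<in> c" "u \<in> c'" for c c' u
      using cls[OF that(1,3)] cls[OF that(2,4)] by (rule trans[OF _ sym])
    have quot: "k div length u > 0" if "length u dvd k" for u :: "'e list"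
      using that k by (auto simp: div_greater_zero_iff dest: dvd_imp_le dvd_pos_nat)
    have finQ: "finite ?Q"
      by (rule finite_subset[OF _ finite_lists_length_le[OF A, of k]])
        (use k in \<open>auto dest: dvd_imp_le\<close>)
    have "(\<Sum>(a, d)\<leftarrow>xs. if d dvd k then of_nat d * a ^ (k div d) else 0) = mat_trace (?P ^\<^sub>m k)"
      by (simp add: xs_def ms(2) o_def)
    also have "\<dots> = (\<Sum>u\<in>?Q. ?tr u)"
      by (simp only: mat_trace_letter_sum_pow[OF M A] sum_words_primitive_roots[OF k])
    also have "\<dots> = (\<Sum>u\<in>\<Union>C. if length u dvd k then ?tr u else 0)"
    proof (rule sum.mono_neutral_cong)
      show "finite (\<Union>C)" using C fin by blast
      show "?tr u = 0" if "u \<in> ?Q - \<Union>C" for u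
        using that vanish quot by blast
      show "(if length u dvd k then ?tr u else 0) = 0" if "u \<in> \<Union>C - ?Q" for u
      proof -
        have "set u \<subseteq> A \<and> valuation u = 1" using that prim by blast
        then show ?thesis using that by simp
      qed
    qed (use finQ in simp_all)
    also have "\<dots> = (\<Sum>c\<in>C. \<Sum>u\<in>c. if length u dvd k then ?tr u else 0)"
    proof (rule sum.Union_disjoint[unfolded o_def])
      show "\<forall>c\<in>C. \<forall>c'\<in>C. c \<noteq> c' \<longrightarrow> c \<inter> c' = {}"
        using disj by blast
    qed (use fin in blast)
    also have "\<dots> = (\<Sum>c\<in>C. if length (r c) dvd k then
        of_nat (length (r c)) * mat_trace (word_mat N M (r c) ^\<^sub>m (k div length (r c))) else 0)"
    proof (rule sum.cong[OF refl])
      fix c assume c: "c \<in> C"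
      \<comment> \<open>The trace is invariant under rotation, so each of the \<open>length (r c)\<close> members contributes the same.\<close>
      have "?tr u = ?tr (r c) \<and> length u = length (r c)" if "u \<in> c" for u
      proof -
        have "u \<in> range (\<lambda>k. rotate k (r c))"
          using subsetD[OF equalityD1[OF cls[OF c r[OF c]]] that] .
        then obtain i where i: "u = rotate i (r c)" by blast
        have "set (word_power (r c) (k div length u)) \<subseteq> A"
          using r_sub[OF c] by (auto simp: word_power_def)
        then have "mat_trace (word_mat N M (rotate i (word_power (r c) (k div length u)))) =
            mat_trace (word_mat N M (word_power (r c) (k div length u)))"
          by (rule mat_trace_word_mat_rotate[OF M])
        then show ?thesis by (simp add: i rotate_word_power)
      qed
      then have "(\<Sum>u\<in>c. if length u dvd k then ?tr u else 0) =
          (\<Sum>u\<in>c. if length (r c) dvd k then ?tr (r c) else 0)"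
        by (intro sum.cong refl) metis
      also have "\<dots> = (if length (r c) dvd k then of_nat (length (r c)) * ?tr (r c) else 0)"
        by (simp add: card[OF c])
      finally show "(\<Sum>u\<in>c. if length u dvd k then ?tr u else 0) =
          (if length (r c) dvd k then
            of_nat (length (r c)) * mat_trace (word_mat N M (r c) ^\<^sub>m (k div length (r c))) else 0)"
        by (simp add: word_mat_word_power[OF M r_sub[OF c]])
    qed
    also have "\<dots> = (\<Sum>c\<leftarrow>cs. \<Sum>l\<leftarrow>ls c. if length (r c) dvd k then
        of_nat (length (r c)) * l ^ (k div length (r c)) else 0)"
      unfolding cs(1)[symmetric] sum_list_distinct_conv_sum_set[OF cs(2), symmetric]
      using ls(2) cs(1) by (intro arg_cong[where f = sum_list] map_cong)
        (auto simp: sum_list_const_mult)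
    also have "\<dots> = (\<Sum>(a, d)\<leftarrow>ys. if d dvd k then of_nat d * a ^ (k div d) else 0)"
      unfolding ys_def by (induction cs) (simp_all add: o_def)
    finally show "(\<Sum>(a, d)\<leftarrow>xs. if d dvd k then of_nat d * a ^ (k div d) else 0) =
        (\<Sum>(a, d)\<leftarrow>ys. if d dvd k then of_nat d * a ^ (k div d) else 0)" .
  qed
  also have "(\<Prod>(a, d)\<leftarrow>ys. 1 - a) = (\<Prod>c\<leftarrow>cs. \<Prod>l\<leftarrow>ls c. 1 - l)"
    unfolding ys_def by (induction cs) (simp_all add: o_def)
  also have "\<dots> = (\<Prod>c\<in>C. det (1\<^sub>m N - word_mat N M (r c)))"
    unfolding cs(1)[symmetric] prod.distinct_set_conv_list[OF cs(2)]
    using ls(1) cs(1) by (intro arg_cong[where f = prod_list] map_cong) auto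
  finally show ?thesis by (simp add: ms(1) xs_def o_def)
qed

section \<open>Block matrices\<close>

lemma distinct_dsum_index: "distinct (dsum_index V n)"
proof -
  have "distinct (concat (map (\<lambda>v. map (Pair v) [0..<n v]) vs))" if "distinct vs" for vs :: "nat list"
    using that by (induction vs) (auto simp: distinct_map inj_on_def)
  then show ?thesis by (simp add: dsum_index_def)
qed

lemma set_dsum_index: "finite V \<Longrightarrow> set (dsum_index V n) = (SIGMA v:V. {..<n v})"
  by (auto simp: dsum_index_def)

lemma dsum_index_nth:
  assumes "finite V" "k < length (dsum_index V n)"
  shows "fst (dsum_index V n ! k) \<in> V" "snd (dsum_index V n ! k) < n (fst (dsum_index V n ! k))"
  using nth_mem[OF assms(2)] unfolding set_dsum_index[OF assms(1)] by auto

lemma bij_betw_dsum_index: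
  "bij_betw ((!) (dsum_index V n)) {..<length (dsum_index V n)} (set (dsum_index V n))"
  by (rule bij_betw_nth[OF distinct_dsum_index refl refl])

abbreviation dsum_dim :: "nat set \<Rightarrow> (nat \<Rightarrow> nat) \<Rightarrow> nat" where
  "dsum_dim V n \<equiv> length (dsum_index V n)"

text \<open>
  The inclusion of the summand at \<open>v\<close>.  Its transpose is the projection onto this summand, so
  that compositions of embedded blocks reduce to \<open>block_incl_orthonormal\<close>.
\<close>

definition block_incl :: "nat set \<Rightarrow> (nat \<Rightarrow> nat) \<Rightarrow> nat \<Rightarrow> complex mat" where
  "block_incl V n v = mat (length (dsum_index V n)) (n v)
    (\<lambda>(k, j). if dsum_index V n ! k = (v, j) then 1 else 0)"

definition block_embed :: "nat set \<Rightarrow> (nat \<Rightarrow> nat) \<Rightarrow> nat \<Rightarrow> nat \<Rightarrow> complex mat \<Rightarrow> complex mat" where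
  "block_embed V n u v X = block_incl V n u * X * transpose_mat (block_incl V n v)"

lemma block_incl_carrier [simp]: "block_incl V n v \<in> carrier_mat (dsum_dim V n) (n v)"
  by (simp add: block_incl_def)

lemma block_embed_carrier [simp]: "block_embed V n u v X \<in> carrier_mat (dsum_dim V n) (dsum_dim V n)"
  by (auto simp: block_embed_def block_incl_def)

lemma block_incl_orthonormal:
  assumes V: "finite V" and u: "u \<in> V"
  shows "transpose_mat (block_incl V n u) * block_incl V n v = (if u = v then 1\<^sub>m (n v) else 0\<^sub>m (n u) (n v))"
proof (rule eq_matI)
  let ?b = "dsum_index V n" and ?N = "dsum_dim V n" and ?J = "block_incl V n"
  fix i j
  assume ij: "i < dim_row (if u = v then 1\<^sub>m (n v) else 0\<^sub>m (n u) (n v) :: complex mat)"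
    "j < dim_col (if u = v then 1\<^sub>m (n v) else 0\<^sub>m (n u) (n v) :: complex mat)"
  then have i: "i < n u" and j: "j < n v" by (auto split: if_splits)
  have "(transpose_mat (?J u) * ?J v) $$ (i, j) =
      (\<Sum>k<?N. (if ?b ! k = (u, i) then 1 else 0) * (if ?b ! k = (v, j) then 1 else 0))"
    using i j by (simp add: block_incl_def scalar_prod_def atLeast0LessThan)
  also have "\<dots> = (\<Sum>p\<in>set ?b. (if p = (u, i) then 1 else 0) * (if p = (v, j) then 1 else 0))"
    by (rule sum.reindex_bij_betw[OF bij_betw_dsum_index])
  also have "\<dots> = (\<Sum>p\<in>set ?b. if p = (u, i) then (if (u, i) = (v, j) then 1 else 0) else 0)"
    by (intro sum.cong) auto
  also have "\<dots> = (if (u, i) = (v, j) then 1 else 0)"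
    using u i V by (simp add: set_dsum_index)
  finally show "(transpose_mat (?J u) * ?J v) $$ (i, j) =
      (if u = v then 1\<^sub>m (n v) else 0\<^sub>m (n u) (n v)) $$ (i, j)"
    using i j by auto
qed (auto simp: block_incl_def)

lemma block_embed_index:
  assumes V: "finite V" and X: "X \<in> carrier_mat (n u) (n v)" and kl: "k < dsum_dim V n" "l < dsum_dim V n"
  shows "block_embed V n u v X $$ (k, l) =
    (if fst (dsum_index V n ! k) = u \<and> fst (dsum_index V n ! l) = v then 
      X $$ (snd (dsum_index V n ! k), snd (dsum_index V n ! l)) else 0)"
proof -
  let ?b = "dsum_index V n" and ?N = "dsum_dim V n" and ?J = "block_incl V n"
  define Z where "Z = ?J u * X"
  have Z: "Z \<in> carrier_mat ?N (n v)"
    unfolding Z_def using block_incl_carrier X by (rule mult_carrier_mat)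
  have left: "Z $$ (k, j) = (if fst (?b ! k) = u then X $$ (snd (?b ! k), j) else 0)"
    if j: "j < n v" for j
  proof -
    have "Z $$ (k, j) = (\<Sum>i<n u. (if ?b ! k = (u, i) then 1 else 0) * X $$ (i, j))"
      using X kl j by (simp add: Z_def block_incl_def scalar_prod_def atLeast0LessThan)
    also have "\<dots> = (\<Sum>i<n u. if i = snd (?b ! k) then
        (if fst (?b ! k) = u then X $$ (snd (?b ! k), j) else 0) else 0)"
      by (intro sum.cong) (auto simp: prod_eq_iff)
    also have "\<dots> = (if fst (?b ! k) = u then X $$ (snd (?b ! k), j) else 0)"
      using dsum_index_nth(2)[OF V kl(1)] by auto
    finally show ?thesis .
  qed
  have "block_embed V n u v X $$ (k, l) =
      (\<Sum>j<n v. Z $$ (k, j) * (if ?b ! l = (v, j) then 1 else 0))"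
    unfolding block_embed_def Z_def[symmetric] using Z kl
    by (simp add: block_incl_def scalar_prod_def atLeast0LessThan)
  also have "\<dots> = (\<Sum>j<n v. if j = snd (?b ! l) then
      (if fst (?b ! l) = v then Z $$ (k, snd (?b ! l)) else 0) else 0)"
    by (intro sum.cong) (auto simp: prod_eq_iff)
  also have "\<dots> = (if fst (?b ! l) = v then Z $$ (k, snd (?b ! l)) else 0)"
    using dsum_index_nth(2)[OF V kl(2)] by auto
  also have "\<dots> = (if fst (?b ! k) = u \<and> fst (?b ! l) = v then X $$ (snd (?b ! k), snd (?b ! l)) else 0)"
    using left dsum_index_nth(2)[OF V kl(2)] by auto
  finally show ?thesis .
qed

lemma block_embed_mult:
  assumes V: "finite V" and X: "X \<in> carrier_mat (n u) (n v)" 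
    and Y: "Y \<in> carrier_mat (n v') (n w)" and v: "v \<in> V"
  shows "block_embed V n u v X * block_embed V n v' w Y =
    (if v = v' then block_embed V n u w (X * Y) else 0\<^sub>m (dsum_dim V n) (dsum_dim V n))"
proof -
  let ?N = "dsum_dim V n" and ?J = "block_incl V n"
  let ?T = "transpose_mat (?J v)"
  have T: "?T \<in> carrier_mat (n v) ?N" and W: "transpose_mat (?J w) \<in> carrier_mat (n w) ?N"
    and Jv': "?J v' \<in> carrier_mat ?N (n v')" and Ju: "?J u \<in> carrier_mat ?N (n u)" by simp_all
  have JX: "?J u * X \<in> carrier_mat ?N (n v)" using Ju X by (rule mult_carrier_mat)
  have YW: "Y * transpose_mat (?J w) \<in> carrier_mat (n v') ?N" using Y W by (rule mult_carrier_mat)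
  have "block_embed V n u v X * block_embed V n v' w Y =
      (?J u * X * ?T) * (?J v' * (Y * transpose_mat (?J w)))"
    unfolding block_embed_def using assoc_mult_mat[OF Jv' Y W] by simp
  also have "\<dots> = ?J u * X * (?T * (?J v' * (Y * transpose_mat (?J w))))"
    using assoc_mult_mat[OF JX T] Jv' YW by (metis mult_carrier_mat)
  also have "\<dots> = ?J u * X * (?T * ?J v' * (Y * transpose_mat (?J w)))"
    using assoc_mult_mat[OF T Jv' YW] by simp
  also have "\<dots> = (if v = v' then block_embed V n u w (X * Y) else 0\<^sub>m ?N ?N)"
  proof (cases "v = v'")
    case True
    have "?J u * X * (Y * transpose_mat (?J w)) = ?J u * (X * Y) * transpose_mat (?J w)"
      using X Y W Ju True assoc_mult_mat[OF JX, of Y "n w" "transpose_mat (?J w)" ?N]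
        assoc_mult_mat[OF Ju X, of Y "n w"] by simp
    then show ?thesis
      using True v left_mult_one_mat[OF YW] by (simp add: block_incl_orthonormal[OF V] block_embed_def)
  next
    case False
    then show ?thesis
      using left_mult_zero_mat[OF YW] right_mult_zero_mat[OF JX]
      by (simp add: block_incl_orthonormal[OF V v])
  qed
  finally show ?thesis .
qed

lemma mat_trace_block_embed_off_diagonal:
  assumes "finite V" "X \<in> carrier_mat (n u) (n v)" "u \<noteq> v"
  shows "mat_trace (block_embed V n u v X) = 0"
proof -
  let ?N = "dsum_dim V n"
  have "block_embed V n u v X $$ (k, k) = 0" if "k < ?N" for k
    using block_embed_index[OF assms(1,2) that that] assms(3) by auto
  then show ?thesis
    using carrier_matD(1)[OF block_embed_carrier, of V n u v X] by (simp add: mat_trace_def)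
qed

text \<open>
  The embedded block is \<open>J (X J\<^sup>T)\<close>, and exchanging the two factors leaves \<open>X (J\<^sup>T J) = X\<close>.
\<close>

lemma det_one_minus_block_embed:
  assumes V: "finite V" and X: "X \<in> carrier_mat (n u) (n u)" and u: "u \<in> V"
  shows "det (1\<^sub>m (dsum_dim V n) - block_embed V n u u X) = det (1\<^sub>m (n u) - X)"
proof -
  let ?N = "dsum_dim V n" and ?J = "block_incl V n"
  have Ju: "?J u \<in> carrier_mat ?N (n u)" and T: "transpose_mat (?J u) \<in> carrier_mat (n u) ?N" by simp_all
  have XT: "X * transpose_mat (?J u) \<in> carrier_mat (n u) ?N" using X T by (rule mult_carrier_mat)
  have "det (1\<^sub>m ?N - block_embed V n u u X) = det (1\<^sub>m ?N - ?J u * (X * transpose_mat (?J u)))"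
    unfolding block_embed_def using assoc_mult_mat[OF Ju X T] by simp
  also have "\<dots> = det (1\<^sub>m (n u) - X * transpose_mat (?J u) * ?J u)"
    by (rule det_one_minus_mult_commute[OF Ju XT])
  also have "X * transpose_mat (?J u) * ?J u = X"
    using assoc_mult_mat[OF X T Ju] X by (simp add: block_incl_orthonormal[OF V u])
  finally show ?thesis .
qed

section \<open>The twisted Laplacian as a block matrix\<close>

text \<open>
  The letters to which \<open>amitsur_identity\<close> is applied: their sum is the transition operator
  of the random walk with probabilities \<^const>\<open>arc_prob\<close>, twisted by \<open>U\<close>.
\<close>

definition transition_block ::
  "(nat, 'e) pre_digraph \<Rightarrow> (nat \<Rightarrow> nat) \<Rightarrow> ('e \<Rightarrow> real) \<Rightarrow> ('e \<Rightarrow> complex mat) \<Rightarrow> 'e \<Rightarrow> complex mat" where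
  "transition_block G n x U e =
    block_embed (verts G) n (tail G e) (head G e) (complex_of_real (arc_prob G x e) \<cdot>\<^sub>m U e)"

lemma det_scale_rows:
  fixes B :: "'a::comm_ring_1 mat"
  assumes B: "B \<in> carrier_mat N N"
  shows "det (mat N N (\<lambda>(k, l). d k * B $$ (k, l))) = (\<Prod>k<N. d k) * det B"
proof -
  have "mat N N (\<lambda>(k, l). d k * B $$ (k, l)) = mat\<^sub>r N N (\<lambda>k. d k \<cdot>\<^sub>v row B k)"
    using B by (intro eq_matI) auto
  moreover have "B = mat\<^sub>r N N (row B)"
    using B by (intro eq_matI) auto
  ultimately show ?thesis
    using det_rows_mul[where n = N and a = "row B" and c = d] B by (auto simp: atLeast0LessThan)
qed

lemma twisted_laplacian_unit_index:
  assumes G: "fin_digraph G"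
    and U: "\<And>e. e \<in> arcs G \<Longrightarrow> U e \<in> carrier_mat (n (tail G e)) (n (head G e))"
    and i: "i < n v" and j: "j < n w"
  shows "twisted_laplacian G n x U (dsum_unit n (w, j)) v $ i =
    complex_of_real (out_weight G x v) * (if (v, i) = (w, j) then 1 else 0) -
    (\<Sum>e\<in>out_arcs G v. if head G e = w then complex_of_real (x e) * U e $$ (i, j) else 0)"
proof -
  let ?f = "dsum_unit n (w, j)"
  let ?t = "\<lambda>e. complex_of_real (x e) \<cdot>\<^sub>v (?f (tail G e) - U e *\<^sub>v ?f (head G e))"
  have f: "?f a \<in> carrier_vec (n a)" for a
    by (simp add: dsum_unit_def)
  have U_v: "U e \<in> carrier_mat (n v) (n (head G e))" "tail G e = v" if "e \<in> out_arcs G v" for e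
    using U[of e] that by auto
  have t_carrier: "?t e \<in> carrier_vec (n v)" if "e \<in> out_arcs G v" for e
    using U_v[OF that] f by auto
  have t_index: "?t e $ i = complex_of_real (x e) * (if (v, i) = (w, j) then 1 else 0) -
      (if head G e = w then complex_of_real (x e) * U e $$ (i, j) else 0)" if e: "e \<in> out_arcs G v" for e
  proof -
    have "?f v $ i = (if (v, i) = (w, j) then 1 else 0)"
      using i j by (auto simp: dsum_unit_def)
    moreover have "(U e *\<^sub>v ?f (head G e)) $ i = (if head G e = w then U e $$ (i, j) else 0)"
      using U_v[OF e] i j by (auto simp: dsum_unit_def)
    ultimately show ?thesis
      using U_v[OF e] f[of v] i by (simp add: right_diff_distrib)
  qed
  have "twisted_laplacian G n x U ?f v $ i = (\<Sum>e\<in>out_arcs G v. ?t e $ i)"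
    unfolding twisted_laplacian_def using t_carrier i fin_digraph.finite_out_arcs[OF G]
    by (intro index_finsum_vec) auto
  also have "\<dots> = (\<Sum>e\<in>out_arcs G v. complex_of_real (x e) * (if (v, i) = (w, j) then 1 else 0) -
      (if head G e = w then complex_of_real (x e) * U e $$ (i, j) else 0))"
    by (rule sum.cong[OF refl t_index])
  finally show ?thesis
    by (simp only: sum_subtractf out_weight_def of_real_sum sum_distrib_right)
qed

text \<open>
  The rows of the Laplacian at \<open>v\<close> are those of \<open>I - P\<close> multiplied by \<open>z\<^sub>v\<close>.  There is no division
  by \<open>z\<^sub>v\<close> in this direction, so a vertex with \<open>z\<^sub>v = 0\<close> is covered: no arc starts there.
\<close>

lemma dsum_det_twisted_laplacian:
  assumes G: "fin_digraph G"
    and z: "\<And>e. e \<in> arcs G \<Longrightarrow> out_weight G x (tail G e) \<noteq> 0"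
    and U: "\<And>e. e \<in> arcs G \<Longrightarrow> U e \<in> carrier_mat (n (tail G e)) (n (head G e))"
  shows "dsum_det (verts G) n (twisted_laplacian G n x U) =
    (\<Prod>a\<in>verts G. complex_of_real (out_weight G x a) ^ n a) *
    det (1\<^sub>m (dsum_dim (verts G) n) -
      letter_sum (dsum_dim (verts G) n) (transition_block G n x U) (arcs G))"
proof -
  note finite_verts = fin_digraph.finite_verts[OF G] and finite_arcs = fin_digraph.finite_arcs[OF G]
  let ?b = "dsum_index (verts G) n"
  let ?N = "length ?b"
  let ?z = "\<lambda>a. complex_of_real (out_weight G x a)"
  let ?B = "1\<^sub>m ?N - letter_sum ?N (transition_block G n x U) (arcs G)"
  have B: "?B \<in> carrier_mat ?N ?N" by (intro minus_carrier_mat letter_sum_carrier)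
  have "dsum_mat (verts G) n (twisted_laplacian G n x U) =
      mat ?N ?N (\<lambda>(k, l). ?z (fst (?b ! k)) * ?B $$ (k, l))"
  proof (rule eq_matI)
    fix k l
    assume "k < dim_row (mat ?N ?N (\<lambda>(k, l). ?z (fst (?b ! k)) * ?B $$ (k, l)))"
      "l < dim_col (mat ?N ?N (\<lambda>(k, l). ?z (fst (?b ! k)) * ?B $$ (k, l)))"
    then have k: "k < ?N" and l: "l < ?N" by simp_all
    obtain v i w j where vi: "?b ! k = (v, i)" and wj: "?b ! l = (w, j)" by fastforce
    have i: "i < n v" and j: "j < n w"
      using dsum_index_nth[OF finite_verts k] dsum_index_nth[OF finite_verts l] by (simp_all add: vi wj)
    have entry: "transition_block G n x U e $$ (k, l) =
        (if tail G e = v \<and> head G e = w then complex_of_real (arc_prob G x e) * U e $$ (i, j) else 0)"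
      if "e \<in> arcs G" for e
      using U[OF that] i j k l
      by (auto simp: transition_block_def block_embed_index[OF finite_verts] vi wj)
    have "?z v * (\<Sum>e\<in>arcs G. transition_block G n x U e $$ (k, l)) =
        (\<Sum>e\<in>arcs G. if tail G e = v then
          (if head G e = w then complex_of_real (x e) * U e $$ (i, j) else 0) else 0)"
      unfolding sum_distrib_left
    proof (rule sum.cong[OF refl])
      fix e assume e: "e \<in> arcs G"
      have "?z (tail G e) * complex_of_real (arc_prob G x e) = complex_of_real (x e)"
        using z[OF e] by (simp add: arc_prob_def)
      then show "?z v * transition_block G n x U e $$ (k, l) = (if tail G e = v then
          (if head G e = w then complex_of_real (x e) * U e $$ (i, j) else 0) else 0)"
        by (auto simp: entry[OF e])
    qed
    also have "\<dots> = (\<Sum>e\<in>out_arcs G v. if head G e = w then complex_of_real (x e) * U e $$ (i, j) else 0)"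
      by (simp add: out_arcs_def sum.inter_filter finite_arcs)
    finally have off: "?z v * (\<Sum>e\<in>arcs G. transition_block G n x U e $$ (k, l)) = \<dots>" .
    have kl: "(v, i) = (w, j) \<longleftrightarrow> k = l"
      using nth_eq_iff_index_eq[OF distinct_dsum_index k l] by (simp add: vi wj)
    have "dsum_mat (verts G) n (twisted_laplacian G n x U) $$ (k, l) =
        twisted_laplacian G n x U (dsum_unit n (w, j)) v $ i"
      using k l by (simp add: dsum_mat_def Let_def vi wj)
    also have "\<dots> = ?z v * (if k = l then 1 else 0) -
        ?z v * (\<Sum>e\<in>arcs G. transition_block G n x U e $$ (k, l))"
      using twisted_laplacian_unit_index[OF G U i j, of x] unfolding off kl by blast
    also have "\<dots> = ?z v * ?B $$ (k, l)"
      using k l by (simp add: letter_sum_def right_diff_distrib)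
    finally show "dsum_mat (verts G) n (twisted_laplacian G n x U) $$ (k, l) =
        mat ?N ?N (\<lambda>(k, l). ?z (fst (?b ! k)) * ?B $$ (k, l)) $$ (k, l)"
      using k l by (simp add: vi)
  qed (simp_all add: dsum_mat_def Let_def)
  then have "dsum_det (verts G) n (twisted_laplacian G n x U) =
      (\<Prod>k<?N. ?z (fst (?b ! k))) * det ?B"
    unfolding dsum_det_def using det_scale_rows[OF B] by simp
  also have "(\<Prod>k<?N. ?z (fst (?b ! k))) = (\<Prod>p\<in>set ?b. ?z (fst p))"
    by (rule prod.reindex_bij_betw[OF bij_betw_dsum_index])
  also have "\<dots> = (\<Prod>a\<in>verts G. ?z a ^ n a)"
    unfolding set_dsum_index[OF finite_verts]
    by (subst prod.Sigma[symmetric, where g = "\<lambda>a i. ?z a", simplified case_prod_unfold])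
      (auto simp: finite_verts)
  finally show ?thesis .
qed

section \<open>Words of arcs\<close>

lemma cas_imp_ends:
  assumes "pre_digraph.cas G u es v" "es \<noteq> []"
  shows "u = tail G (hd es)" "v = head G (last es)"
proof -
  show "u = tail G (hd es)"
    using assms by (cases es) (auto simp: pre_digraph.cas.simps)
  show "v = head G (last es)"
    using assms by (induction es arbitrary: u) (auto simp: pre_digraph.cas.simps split: if_splits)
qed

lemma closed_w_iff_cas:
  assumes wf: "wf_digraph G" and es: "es \<noteq> []" "set es \<subseteq> arcs G"
  shows "wf_digraph.closed_w G es \<longleftrightarrow>
    pre_digraph.cas G (tail G (hd es)) es (head G (last es)) \<and> tail G (hd es) = head G (last es)"
proof -
  note closed_w_def = wf_digraph.closed_w_def[OF wf] and awalk_def = pre_digraph.awalk_def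
  have hd_in: "tail G (hd es) \<in> verts G"
    using es by (intro wf_digraph.tail_in_verts[OF wf]) (cases es; auto)
  show ?thesis
  proof
    assume "wf_digraph.closed_w G es"
    then obtain u where u: "pre_digraph.cas G u es u" by (auto simp: closed_w_def awalk_def)
    show "pre_digraph.cas G (tail G (hd es)) es (head G (last es)) \<and> tail G (hd es) = head G (last es)"
      using u cas_imp_ends[OF u es(1)] by simp
  next
    assume "pre_digraph.cas G (tail G (hd es)) es (head G (last es)) \<and> tail G (hd es) = head G (last es)"
    then have "pre_digraph.awalk G (tail G (hd es)) es (tail G (hd es))"
      using hd_in es(2) unfolding awalk_def by metis
    then show "wf_digraph.closed_w G es" using es(1) by (auto simp: closed_w_def)
  qed
qed

text \<open>
  If \<open>u\<^sup>m\<close> is a closed walk with \<open>m > 1\<close>, then a second copy of \<open>u\<close> starts at the end of the first one,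
  and the start of a nonempty walk is determined by its first arc.
\<close>

lemma closed_w_word_power_imp:
  assumes "wf_digraph G" and closed: "wf_digraph.closed_w G (word_power u m)"
  shows "wf_digraph.closed_w G u"
proof -
  interpret wf_digraph G by fact
  obtain a where a: "awalk a (word_power u m) a" "word_power u m \<noteq> []"
    using closed unfolding closed_w_def by (metis length_greater_0_conv)
  obtain k where m: "m = Suc k" using a(2) by (cases m) auto
  have ne: "u \<noteq> []" using a(2) by (auto simp: word_power_def)
  obtain c where c: "awalk a u c" "awalk c (word_power u k) a"
    using a(1) unfolding m by auto
  have "a = c"
  proof (cases k)
    case 0
    then show ?thesis using c(2) by (auto simp: awalk_Nil_iff)
  next
    case (Suc l)
    then obtain c' where "awalk c u c'" using c(2) by auto
    then show ?thesis
      using c(1) ne cas_imp_ends(1)[of G _ u] unfolding awalk_def by metis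
  qed
  then show ?thesis using c(1) ne by (auto simp: closed_w_def)
qed

text \<open>
  Blocks of consecutive arcs compose when the head of the first is the tail of the second, and
  have product zero otherwise.
\<close>

lemma word_mat_transition_block:
  fixes U :: "'e \<Rightarrow> complex mat"
  assumes G: "fin_digraph G"
    and U: "\<And>e. e \<in> arcs G \<Longrightarrow> U e \<in> carrier_mat (n (tail G e)) (n (head G e))"
    and es: "es \<noteq> []" "set es \<subseteq> arcs G"
  shows "word_mat (dsum_dim (verts G) n) (transition_block G n x U) es =
    (if pre_digraph.cas G (tail G (hd es)) es (head G (last es)) then
      block_embed (verts G) n (tail G (hd es)) (head G (last es))
        (complex_of_real (\<Prod>e\<leftarrow>es. arc_prob G x e) \<cdot>\<^sub>m
          foldr (\<lambda>e M. U e * M) es (1\<^sub>m (n (head G (last es)))))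
     else 0\<^sub>m (dsum_dim (verts G) n) (dsum_dim (verts G) n))"
  using es
proof (induction es rule: list_nonempty_induct)
  case (single e)
  have "U e * 1\<^sub>m (n (head G e)) = U e" using U[of e] single by simp
  then show ?case
    by (simp add: word_mat_def transition_block_def pre_digraph.cas.simps
        right_mult_one_mat[OF block_embed_carrier])
next
  case (cons e es)
  note finite_verts = fin_digraph.finite_verts[OF G] and wf = fin_digraph.axioms(1)[OF G]
  let ?N = "dsum_dim (verts G) n" and ?W = "transition_block G n x U"
  let ?a = "tail G (hd es)" and ?v = "head G (last es)"
  let ?p = "\<lambda>e. complex_of_real (arc_prob G x e)" and ?q = "complex_of_real (\<Prod>e\<leftarrow>es. arc_prob G x e)"
  let ?F = "foldr (\<lambda>e M. U e * M) es (1\<^sub>m (n ?v))"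
  have e: "e \<in> arcs G" and sub: "set es \<subseteq> arcs G" using cons.prems by auto
  have Ue: "U e \<in> carrier_mat (n (tail G e)) (n (head G e))" using U[OF e] .
  have W: "?W e \<in> carrier_mat ?N ?N"
    unfolding transition_block_def by (rule block_embed_carrier)
  have cas_Cons: "pre_digraph.cas G (tail G e) (e # es) ?v \<longleftrightarrow> head G e = ?a \<and> pre_digraph.cas G ?a es ?v"
    using cas_imp_ends(1)[of G "head G e" es ?v] by (auto simp: pre_digraph.cas.simps cons.hyps)
  have IH: "word_mat ?N ?W (e # es) = ?W e * (if pre_digraph.cas G ?a es ?v then
      block_embed (verts G) n ?a ?v (?q \<cdot>\<^sub>m ?F) else 0\<^sub>m ?N ?N)"
    using cons.IH[OF sub] by (simp add: word_mat_def)
  show ?case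
  proof (cases "pre_digraph.cas G ?a es ?v")
    case True
    have F: "?F \<in> carrier_mat (n ?a) (n ?v)"
      using foldr_mat_carrier[OF U sub True one_carrier_mat] by blast
    have scal: "(?p e \<cdot>\<^sub>m U e) * (?q \<cdot>\<^sub>m ?F) = (?p e * ?q) \<cdot>\<^sub>m (U e * ?F)" if "head G e = ?a"
      using Ue F that
    proof -
      have "U e \<in> carrier_mat (n (tail G e)) (n ?a)" using Ue that by simp
      then show ?thesis using F
        by (simp add: mult_smult_assoc_mat[OF _ smult_carrier_mat] mult_smult_distrib) (auto intro!: eq_matI)
    qed
    have "?W e * block_embed (verts G) n ?a ?v (?q \<cdot>\<^sub>m ?F) =
        (if head G e = ?a then block_embed (verts G) n (tail G e) ?v ((?p e * ?q) \<cdot>\<^sub>m (U e * ?F))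
         else 0\<^sub>m ?N ?N)"
      unfolding transition_block_def
      using block_embed_mult[OF finite_verts smult_carrier_mat[OF Ue] smult_carrier_mat[OF F]
          wf_digraph.head_in_verts[OF wf e], of "?p e" ?q] scal by simp
    then show ?thesis
      unfolding IH using True cas_Cons cons.hyps by simp
  next
    case False
    then show ?thesis
      unfolding IH using cas_Cons cons.hyps right_mult_zero_mat[OF W] by simp
  qed
qed

lemma det_one_minus_word_mat_closed:
  fixes U :: "'e \<Rightarrow> complex mat"
  assumes G: "fin_digraph G"
    and U: "\<And>e. e \<in> arcs G \<Longrightarrow> U e \<in> carrier_mat (n (tail G e)) (n (head G e))"
    and closed: "wf_digraph.closed_w G es"
  shows "det (1\<^sub>m (dsum_dim (verts G) n) -
      word_mat (dsum_dim (verts G) n) (transition_block G n x U) es) =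
    cycle_det G n (arc_prob G x) U es"
proof -
  note finite_verts = fin_digraph.finite_verts[OF G] and wf = fin_digraph.axioms(1)[OF G]
  have es: "es \<noteq> []" "set es \<subseteq> arcs G"
    using closed by (auto simp: wf_digraph.closed_w_def[OF wf] pre_digraph.awalk_def)
  let ?a = "tail G (hd es)"
  have cas: "pre_digraph.cas G ?a es ?a" and last: "head G (last es) = ?a"
    using closed closed_w_iff_cas[OF wf es] by auto
  have a: "?a \<in> verts G" using es by (intro wf_digraph.tail_in_verts[OF wf]) (cases es; auto)
  have "foldr (\<lambda>e M. U e * M) es (1\<^sub>m (n ?a)) \<in> carrier_mat (n ?a) (n ?a)"
    using foldr_mat_carrier[OF U es(2) cas one_carrier_mat] by blast
  then show ?thesis
    using cas by (simp add: word_mat_transition_block[OF G U es] last cycle_det_def holonomy_def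
        det_one_minus_block_embed[OF finite_verts _ a])
qed

text \<open>
  The matrix of the word is zero or has its only block off the diagonal.
\<close>

lemma mat_trace_word_mat_not_closed:
  fixes U :: "'e \<Rightarrow> complex mat"
  assumes G: "fin_digraph G"
    and U: "\<And>e. e \<in> arcs G \<Longrightarrow> U e \<in> carrier_mat (n (tail G e)) (n (head G e))"
    and es: "es \<noteq> []" "set es \<subseteq> arcs G" and not_closed: "\<not> wf_digraph.closed_w G es"
  shows "mat_trace (word_mat (dsum_dim (verts G) n) (transition_block G n x U) es) = 0"
proof -
  note finite_verts = fin_digraph.finite_verts[OF G] and wf = fin_digraph.axioms(1)[OF G]
  let ?a = "tail G (hd es)" and ?v = "head G (last es)"
  show ?thesis
  proof (cases "pre_digraph.cas G ?a es ?v")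
    case True
    then have "?a \<noteq> ?v" using not_closed closed_w_iff_cas[OF wf es] by blast
    moreover have "foldr (\<lambda>e M. U e * M) es (1\<^sub>m (n ?v)) \<in> carrier_mat (n ?a) (n ?v)"
      using foldr_mat_carrier[OF U es(2) True one_carrier_mat] by blast
    ultimately show ?thesis
      using True by (simp add: word_mat_transition_block[OF G U es]
          mat_trace_block_embed_off_diagonal[OF finite_verts])
  next
    case False
    then show ?thesis
      by (simp add: word_mat_transition_block[OF G U es] mat_trace_def)
  qed
qed

lemma prime_cycle_memberD:
  assumes wf: "wf_digraph G" and c: "c \<in> prime_cycles G" and u: "u \<in> c"
  shows "wf_digraph.closed_w G u" "valuation u = 1" "c = range (\<lambda>k. rotate k u)"
proof -
  have cyc: "c \<in> cycles G" and val: "valuation (cycle_rep c) = 1"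
    using c by (auto simp: prime_cycles_def)
  show closed: "wf_digraph.closed_w G u"
    using cyc u in_quotient_imp_subset[OF equiv_cycle_rel] by (fastforce simp: cycles_def)
  show "valuation u = 1" using valuation_cycle_rep[OF cyc u] val by simp
  have q: "c \<in> {es. wf_digraph.closed_w G es} // cycle_rel G"
    using cyc by (simp add: cycles_def)
  have "c = cycle_rel G `` {u}"
  proof (rule Set.set_eqI)
    fix w
    show "w \<in> c \<longleftrightarrow> w \<in> cycle_rel G `` {u}"
      using in_quotient_imp_in_rel[OF equiv_cycle_rel q, of u w]
        in_quotient_imp_closed[OF equiv_cycle_rel q u, of w] u by blast
  qed
  moreover have "wf_digraph.closed_w G (rotate k u)" for k
    by (induction k) (simp_all add: closed closed_w_rotate1[OF wf])
  ultimately show "c = range (\<lambda>k. rotate k u)"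
    using closed unfolding cycle_rel_def by blast
qed

lemma prime_closed_word_in_prime_cycle:
  assumes closed: "wf_digraph.closed_w G u" and prim: "valuation u = 1"
  shows "u \<in> \<Union>(prime_cycles G)"
proof -
  let ?c = "cycle_rel G `` {u}"
  have u: "u \<in> ?c" using closed by (auto simp: cycle_rel_def intro: exI[of _ 0])
  have c: "?c \<in> cycles G" using closed by (auto simp: cycles_def intro: quotientI)
  then have "?c \<in> prime_cycles G"
    using valuation_cycle_rep[OF c u] prim by (simp add: prime_cycles_def)
  with u show ?thesis by blast
qed

theorem corollary1p9:
  fixes G :: "(nat, 'e) pre_digraph"
    and p :: nat
    and n :: "nat \<Rightarrow> nat"
    and x :: "'e \<Rightarrow> real"
    and U :: "'e \<Rightarrow> complex mat"
  assumes "fin_digraph G" and "loopfree_digraph G"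
    and "verts G = {1..p}"
    and "\<And>v. v \<in> verts G \<Longrightarrow> n v \<ge> 1"
    and "\<And>e. e \<in> arcs G \<Longrightarrow> x e \<ge> 0"
    and "\<And>e. e \<in> arcs G \<Longrightarrow> out_weight G x (tail G e) \<noteq> 0"
    and "\<And>e. e \<in> arcs G \<Longrightarrow> U e \<in> carrier_mat (n (tail G e)) (n (head G e))"
    and "finite (prime_cycles G)"
  shows "dsum_det (verts G) n (twisted_laplacian G n x U) =
    (\<Prod>a\<in>verts G. complex_of_real (out_weight G x a) ^ n a) *
    (\<Prod>c\<in>prime_cycles G. cycle_det G n (arc_prob G x) U (cycle_rep c))"
proof -
  note wf = fin_digraph.axioms(1)[OF assms(1)]
  note U = assms(7) and member = prime_cycle_memberD[OF wf]
  let ?N = "dsum_dim (verts G) n" and ?W = "transition_block G n x U"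
  have rep: "cycle_rep c \<in> c" if "c \<in> prime_cycles G" for c
    using that cycle_rep_in by (auto simp: prime_cycles_def)
  have "det (1\<^sub>m ?N - letter_sum ?N ?W (arcs G)) =
      (\<Prod>c\<in>prime_cycles G. det (1\<^sub>m ?N - word_mat ?N ?W (cycle_rep c)))"
  proof (rule amitsur_identity)
    show "?W \<in> arcs G \<rightarrow> carrier_mat ?N ?N"
      by (simp add: transition_block_def)
    show "set u \<subseteq> arcs G \<and> valuation u = 1" if "c \<in> prime_cycles G" "u \<in> c" for c u
      using member(1,2)[OF that] by (auto simp: wf_digraph.closed_w_def[OF wf] pre_digraph.awalk_def)
    show "mat_trace (word_mat ?N ?W (word_power u m)) = 0"
      if u: "set u \<subseteq> arcs G" "valuation u = 1" "u \<notin> \<Union>(prime_cycles G)" and m: "m > 0" for u m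
    proof (rule mat_trace_word_mat_not_closed[OF assms(1) U])
      show "\<not> wf_digraph.closed_w G (word_power u m)"
        using u(2,3) closed_w_word_power_imp[OF wf] prime_closed_word_in_prime_cycle by blast
      show "set (word_power u m) \<subseteq> arcs G" using u(1) m by (simp add: set_word_power)
      show "word_power u m \<noteq> []" using u(2) m primitive_iff by (cases m) auto
    qed
    show "c = range (\<lambda>k. rotate k u)" if "c \<in> prime_cycles G" "u \<in> c" for c u
      by (rule member(3)[OF that])
  qed (simp_all add: rep assms(8) fin_digraph.finite_arcs[OF assms(1)])
  also have "\<dots> = (\<Prod>c\<in>prime_cycles G. cycle_det G n (arc_prob G x) U (cycle_rep c))"
    by (intro prod.cong refl det_one_minus_word_mat_closed[OF assms(1) U] member(1)[OF _ rep])
  finally show ?thesis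
    by (simp only: dsum_det_twisted_laplacian[OF assms(1,6) U])
qed

end
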